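(* Let $\mathscr{G}=(S,B)$ be a countably infinite, simple, connected, undirected graph of bounded degree with exponential growth rate $\theta$, let $E$ be a finite set, and let $\mu$ be a non-degenerate probability measure on $\Omega=E^{S}$. Fix $\lambda>3\theta$ and $k\in\mathbb{N}_0$. If $\mu$ is $k$-Markovian and $\phi$-mixing with exponential decay rate $\lambda$, then $\mu$ is $\psi$-mixing with exponential decay rate $(\lambda-3\theta)/9$.
   Context: Let $d$ be the path metric on $S$ (length of a shortest path), $d(s,\Lambda)=\min_{t\in\Lambda}d(s,t)$, and $B_n(s)=\{t\in S: d(s,t)\le n\}$. The exponential growth rate $\theta$ of $\mathscr{G}$ is the infimum of all $\theta'\in[0,\infty)$ such that $|B_n(s)|\le e^{\theta' n}$ for every $s\in S$ and every $n\in\mathbb{N}=\{1,2,\dots\}$. For $k\in\mathbb{N}_0$ and $\Lambda\subseteq S$, the $k$-boundary is $\partial_k\Lambda=\{s\in\Lambda^c: d(s,\Lambda)\le k\}$. $\Omega=E^S$ carries the product topology and its Borel $\sigma$-algebra $\mathscr{F}$; $\sigma_s:\Omega\to E$ are the coordinate projections; for $\Lambda\subseteq S$, $\omega_\Lambda$ is the restriction of $\omega$ to $\Lambda$ and $\mathscr{F}_\Lambda$ is the $\sigma$-algebra generated by $\{\sigma_s: s\in\Lambda\}$. $\Lambda\sqsubseteq S$ means that $\Lambda$ is a finite subset of $S$. For a probability measure $\mu$ on $(\Omega,\mathscr{F})$, $(\mu_\Lambda)_{\Lambda\sqsubseteq S}$ denotes its regular conditional probabilities: $\mu_\Lambda$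 is a probability kernel $\omega\mapsto\mu_\Lambda^\omega$ from $\mathscr{F}_{\Lambda^c}$ to $\mathscr{F}_\Lambda$ with $\mu_\Lambda^\omega(A)=\mathbb{E}[1_A\mid\mathscr{F}_{\Lambda^c}](\omega)$ for $\mu$-almost all $\omega$, for every $A\in\mathscr{F}_\Lambda$. The measure $\mu$ is non-degenerate if for every $\Lambda\sqsubseteq S$ and $A\in\mathscr{F}_\Lambda$ with $\mu(A)>0$ one has $\mu_\Lambda^\omega(A)>0$ for $\mu$-almost all $\omega$. It is $k$-Markovian if for every $\Lambda\sqsubseteq S$, for $\mu$-almost all $\omega,\tau\in\Omega$ (i.e. for all $\omega,\tau$ in a set of full measure), $\omega_{\partial_k\Lambda}=\tau_{\partial_k\Lambda}$ implies $\mu_\Lambda^\omega=\mu_\Lambda^\tau$. For $U,V\subseteq S$ the mixing coefficients are $$\phi(U,V)=\sup|\mu(A|B)-\mu(A)|,\qquad \psi(U,V)=\sup\left|\frac{\mu(A\cap B)}{\mu(A)\mu(B)}-1\right|,$$ the suprema being over $A\in\mathscr{F}_U$, $B\in\mathscr{F}_V$ of positive measure. For $\lambda>0$ put $\Sigma(\lambda,U,V)=\sum_{t\in U}\sum_{s\in V}e^{-\lambda d(t,s)}\in[0,\infty]$. For $\pi\in\{\phi,\psi\}$, $\mu$ is called $\pi$-mixing with exponential decay rate $\lambda$ if there is a constant $C\ge1$ such that $\pi(U,V)\le C\,\Sigma(\lambda,U,V)$ for all $U,V\subseteq S$ with $C\,\Sigma(\lambda,U,V)<1$. *)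

theory Defs
  imports "HOL-Probability.Probability"
begin

text \<open>A simple undirected graph is given by its vertex set \<open>S\<close> and its set \<open>B\<close> of edges, each
  edge being an unordered pair of distinct vertices.\<close>

definition simple_graph :: "'s set \<Rightarrow> 's set set \<Rightarrow> bool" where
  "simple_graph S B \<longleftrightarrow> (\<forall>e\<in>B. \<exists>s\<in>S. \<exists>t\<in>S. s \<noteq> t \<and> e = {s, t})"

definition graph_path :: "'s set \<Rightarrow> 's set set \<Rightarrow> 's \<Rightarrow> 's list \<Rightarrow> 's \<Rightarrow> bool" where
  "graph_path S B s p t \<longleftrightarrow>
     p \<noteq> [] \<and> hd p = s \<and> last p = t \<and> set p \<subseteq> S \<and> distinct p \<and>
     successively (\<lambda>u v. {u, v} \<in> B) p"

definition connected_graph :: "'s set \<Rightarrow> 's set set \<Rightarrow> bool" where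
  "connected_graph S B \<longleftrightarrow> (\<forall>s\<in>S. \<forall>t\<in>S. \<exists>p. graph_path S B s p t)"

definition bounded_degree :: "'s set \<Rightarrow> 's set set \<Rightarrow> bool" where
  "bounded_degree S B \<longleftrightarrow>
     (\<exists>D::nat. \<forall>s\<in>S. finite {t\<in>S. {s, t} \<in> B} \<and> card {t\<in>S. {s, t} \<in> B} \<le> D)"

text \<open>The length of a path is its number of edges. The value of \<open>graph_dist\<close> is meaningful only if
  \<open>s\<close> and \<open>t\<close> are joined by a path.\<close>

definition graph_dist :: "'s set \<Rightarrow> 's set set \<Rightarrow> 's \<Rightarrow> 's \<Rightarrow> nat" where
  "graph_dist S B s t = (LEAST n. \<exists>p. graph_path S B s p t \<and> length p = Suc n)"

text \<open>Taking the infimum in \<^typ>\<open>enat\<close> makes the distance to the empty set \<open>\<infinity>\<close>; for nonempty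
  sets the infimum is a minimum.\<close>

definition graph_setdist :: "'s set \<Rightarrow> 's set set \<Rightarrow> 's \<Rightarrow> 's set \<Rightarrow> enat" where
  "graph_setdist S B s \<Lambda> = (INF t\<in>\<Lambda>. enat (graph_dist S B s t))"

definition graph_ball :: "'s set \<Rightarrow> 's set set \<Rightarrow> nat \<Rightarrow> 's \<Rightarrow> 's set" where
  "graph_ball S B n s = {t\<in>S. graph_dist S B s t \<le> n}"

definition growth_rate :: "'s set \<Rightarrow> 's set set \<Rightarrow> real" where
  "growth_rate S B =
     Inf {\<theta>'. \<theta>' \<ge> 0 \<and> (\<forall>s\<in>S. \<forall>n\<ge>1. real (card (graph_ball S B n s)) \<le> exp (\<theta>' * real n))}"

definition boundary :: "'s set \<Rightarrow> 's set set \<Rightarrow> nat \<Rightarrow> 's set \<Rightarrow> 's set" where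
  "boundary S B k \<Lambda> = {s \<in> S - \<Lambda>. graph_setdist S B s \<Lambda> \<le> enat k}"

definition config_space :: "'s set \<Rightarrow> 'e set \<Rightarrow> ('s \<Rightarrow> 'e) set" where
  "config_space S E = (\<Pi>\<^sub>E s\<in>S. E)"

text \<open>The \<open>\<sigma>\<close>-algebras are represented as elements of the type of measures; only their \<open>space\<close>
  and \<open>sets\<close> components matter.\<close>

definition config_borel :: "'s set \<Rightarrow> 'e set \<Rightarrow> ('s \<Rightarrow> 'e) measure" where
  "config_borel S E =
     sigma (config_space S E) {U. openin (product_topology (\<lambda>_. discrete_topology E) S) U}"

definition local_algebra :: "'s set \<Rightarrow> 'e set \<Rightarrow> 's set \<Rightarrow> ('s \<Rightarrow> 'e) measure" where
  "local_algebra S E \<Lambda> =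
     sigma (config_space S E) {{\<omega> \<in> config_space S E. \<omega> s \<in> X} | s X. s \<in> \<Lambda> \<and> X \<subseteq> E}"

text \<open>\<open>\<kappa>\<close> is a family of versions of the regular conditional probabilities: \<open>\<kappa> \<Lambda> \<omega>\<close> is
  \<open>\<mu>\<^sub>\<Lambda>\<^sup>\<omega>\<close>, a probability measure on \<open>local_algebra S E \<Lambda>\<close> depending measurably on \<open>\<omega>\<close>.\<close>

definition regular_cond_probs ::
  "'s set \<Rightarrow> 'e set \<Rightarrow> ('s \<Rightarrow> 'e) measure \<Rightarrow> ('s set \<Rightarrow> ('s \<Rightarrow> 'e) \<Rightarrow> ('s \<Rightarrow> 'e) measure) \<Rightarrow> bool" where
  "regular_cond_probs S E \<mu> \<kappa> \<longleftrightarrow>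
     (\<forall>\<Lambda>. finite \<Lambda> \<and> \<Lambda> \<subseteq> S \<longrightarrow>
        \<kappa> \<Lambda> \<in> local_algebra S E (S - \<Lambda>) \<rightarrow>\<^sub>M prob_algebra (local_algebra S E \<Lambda>) \<and>
        (\<forall>A \<in> sets (local_algebra S E \<Lambda>). AE \<omega> in \<mu>.
           measure (\<kappa> \<Lambda> \<omega>) A = real_cond_exp \<mu> (local_algebra S E (S - \<Lambda>)) (indicator A) \<omega>))"

definition nondegenerate ::
  "'s set \<Rightarrow> 'e set \<Rightarrow> ('s \<Rightarrow> 'e) measure \<Rightarrow> ('s set \<Rightarrow> ('s \<Rightarrow> 'e) \<Rightarrow> ('s \<Rightarrow> 'e) measure) \<Rightarrow> bool" where
  "nondegenerate S E \<mu> \<kappa> \<longleftrightarrow>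
     (\<forall>\<Lambda>. finite \<Lambda> \<and> \<Lambda> \<subseteq> S \<longrightarrow>
        (\<forall>A \<in> sets (local_algebra S E \<Lambda>). measure \<mu> A > 0 \<longrightarrow>
           (AE \<omega> in \<mu>. measure (\<kappa> \<Lambda> \<omega>) A > 0)))"

definition markovian ::
  "'s set \<Rightarrow> 's set set \<Rightarrow> nat \<Rightarrow> ('s \<Rightarrow> 'e) measure \<Rightarrow>
     ('s set \<Rightarrow> ('s \<Rightarrow> 'e) \<Rightarrow> ('s \<Rightarrow> 'e) measure) \<Rightarrow> bool" where
  "markovian S B k \<mu> \<kappa> \<longleftrightarrow>
     (\<forall>\<Lambda>. finite \<Lambda> \<and> \<Lambda> \<subseteq> S \<longrightarrow>
        (\<exists>\<Omega>' \<in> sets \<mu>. measure \<mu> \<Omega>' = 1 \<and>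
           (\<forall>\<omega>\<in>\<Omega>'. \<forall>\<tau>\<in>\<Omega>'.
              restrict \<omega> (boundary S B k \<Lambda>) = restrict \<tau> (boundary S B k \<Lambda>) \<longrightarrow>
              \<kappa> \<Lambda> \<omega> = \<kappa> \<Lambda> \<tau>)))"

text \<open>The mixing coefficients take values in \<^typ>\<open>ennreal\<close> because the supremum defining
  \<open>\<psi>\<close> may be infinite.\<close>

definition phi_coeff ::
  "'s set \<Rightarrow> 'e set \<Rightarrow> ('s \<Rightarrow> 'e) measure \<Rightarrow> 's set \<Rightarrow> 's set \<Rightarrow> ennreal" where
  "phi_coeff S E \<mu> U V =
     Sup {ennreal \<bar>cond_prob \<mu> (\<lambda>\<omega>. \<omega> \<in> A) (\<lambda>\<omega>. \<omega> \<in> A') - measure \<mu> A\<bar> | A A'.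
            A \<in> sets (local_algebra S E U) \<and> A' \<in> sets (local_algebra S E V) \<and>
            measure \<mu> A > 0 \<and> measure \<mu> A' > 0}"

definition psi_coeff ::
  "'s set \<Rightarrow> 'e set \<Rightarrow> ('s \<Rightarrow> 'e) measure \<Rightarrow> 's set \<Rightarrow> 's set \<Rightarrow> ennreal" where
  "psi_coeff S E \<mu> U V =
     Sup {ennreal \<bar>measure \<mu> (A \<inter> A') / (measure \<mu> A * measure \<mu> A') - 1\<bar> | A A'.
            A \<in> sets (local_algebra S E U) \<and> A' \<in> sets (local_algebra S E V) \<and>
            measure \<mu> A > 0 \<and> measure \<mu> A' > 0}"

definition decay_sum :: "'s set \<Rightarrow> 's set set \<Rightarrow> real \<Rightarrow> 's set \<Rightarrow> 's set \<Rightarrow> ennreal" where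
  "decay_sum S B l U V =
     (\<Sum>\<^sub>\<infinity>t\<in>U. \<Sum>\<^sub>\<infinity>s\<in>V. ennreal (exp (- l * real (graph_dist S B t s))))"

text \<open>The argument \<open>\<pi>\<close> is a mixing coefficient, such as \<open>phi_coeff S E \<mu>\<close> or
  \<open>psi_coeff S E \<mu>\<close>.\<close>

definition exp_mixing ::
  "'s set \<Rightarrow> 's set set \<Rightarrow> ('s set \<Rightarrow> 's set \<Rightarrow> ennreal) \<Rightarrow> real \<Rightarrow> bool" where
  "exp_mixing S B \<pi> l \<longleftrightarrow>
     (\<exists>C::real. C \<ge> 1 \<and>
        (\<forall>U V. U \<subseteq> S \<and> V \<subseteq> S \<and> ennreal C * decay_sum S B l U V < 1 \<longrightarrow>
           \<pi> U V \<le> ennreal C * decay_sum S B l U V))"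

end

theory Submission
  imports Defs
begin

text \<open>
  The proof compares the joint law of two events \<open>A\<close> (near \<open>U\<close>) and \<open>Q\<close> (near \<open>V\<close>) with an
  intermediate finite set \<open>W\<close> that separates \<open>U\<close> from \<open>V\<close> in the sense of the Markov property and lies
  about halfway between them. For a configuration \<open>w\<close> on \<open>W\<close>, conditional independence gives
  \<open>\<mu>(A \<inter> Q) / (\<mu>(A) \<mu>(Q)) = (\<mu>(w|A) / \<mu>(w)) (\<mu>(w|Q) / \<mu>(w)) / (\<mu>(w|A \<inter> Q) / \<mu>(w))\<close>.
  By \<open>\<phi>\<close>-mixing of \<open>W\<close> against \<open>U \<union> V\<close>, the laws of \<open>w\<close> given \<open>A\<close>, given \<open>Q\<close> and given \<open>A \<inter> Q\<close> are all
  \<open>\<epsilon>\<close>-close to the unconditioned one in total variation, so each of the three ratios on the right is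
  within \<open>O(\<epsilon>)\<close> of \<open>1\<close> off a set of \<open>w\<close> of probability less than \<open>1/3\<close>. A single \<open>w\<close> that is good for
  all three determines the left-hand side up to \<open>O(\<epsilon>)\<close>. Since \<open>U\<close> must be finite for the Markov property
  to apply, the general case follows by approximating \<open>A\<close> by events on finitely many sites.
\<close>

section \<open>Distances, balls and separating sets\<close>

locale bounded_degree_graph =
  fixes S :: "'s set" and B :: "'s set set"
  assumes simple: "simple_graph S B"
    and connected: "connected_graph S B"
    and degree: "bounded_degree S B"
begin

abbreviation d :: "'s \<Rightarrow> 's \<Rightarrow> nat" where "d \<equiv> graph_dist S B"

section \<open>Graph distance through walks, that is, powers of the adjacency relation\<close>

definition adj :: "('s \<times> 's) set" where "adj = {(u, v). {u, v} \<in> B}"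

lemma adj_in_S: "(u, v) \<in> adj \<Longrightarrow> u \<in> S \<and> v \<in> S"
  using simple by (fastforce simp: adj_def simple_graph_def doubleton_eq_iff)

lemma sym_adj: "sym adj"
  by (auto simp: sym_def adj_def insert_commute)

lemma sym_relpow_adj: "(s, t) \<in> adj ^^ n \<Longrightarrow> (t, s) \<in> adj ^^ n"
proof (induction n arbitrary: t)
  case (Suc n)
  then obtain u where "(s, u) \<in> adj ^^ n" "(u, t) \<in> adj" by auto
  with Suc.IH sym_adj show ?case by (meson relpow_Suc_I2 symD)
qed auto

lemma graph_path_imp_relpow:
  assumes "graph_path S B s p t" "length p = Suc n"
  shows "(s, t) \<in> adj ^^ n"
  unfolding relpow_fun_conv
  using assms
  by (intro exI[of _ "\<lambda>i. p ! i"])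
     (auto simp: graph_path_def adj_def hd_conv_nth last_conv_nth successively_conv_nth)

text \<open>A shortest walk visits no vertex twice, since the section between two visits could be
  cut out. So the distinctness demanded by \<open>graph_path\<close> does not change the least
  length, and distances can be computed with walks, which concatenate and reverse freely.\<close>

lemma minimal_relpow_imp_graph_path:
  assumes st: "(s, t) \<in> adj ^^ n" and min: "\<And>m. m < n \<Longrightarrow> (s, t) \<notin> adj ^^ m" and "s \<in> S"
  shows "\<exists>p. graph_path S B s p t \<and> length p = Suc n"
proof -
  obtain f where f: "f 0 = s" "f n = t" "\<And>i. i < n \<Longrightarrow> (f i, f (Suc i)) \<in> adj"
    using st unfolding relpow_fun_conv by auto
  have sub: "(f i, f (i + m)) \<in> adj ^^ m" if "i + m \<le> n" for i m
    unfolding relpow_fun_conv by (rule exI[of _ "\<lambda>j. f (i + j)"]) (use that f in auto)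
  have ne: "f i \<noteq> f j" if "i < j" "j \<le> n" for i j
  proof
    assume eq: "f i = f j"
    have "(s, f i) \<in> adj ^^ i" using sub[of 0 i] f that by auto
    moreover have "(f i, t) \<in> adj ^^ (n - j)" using sub[of j "n - j"] f that eq by auto
    ultimately have "(s, t) \<in> adj ^^ (i + (n - j))" by (auto simp: relpow_add)
    with min[of "i + (n - j)"] that show False by auto
  qed
  let ?p = "map f [0..<Suc n]"
  have fS: "f i \<in> S" if "i \<le> n" for i
    using that f(1) f(3)[of "i - 1"] adj_in_S \<open>s \<in> S\<close> by (cases i) fastforce+
  have "inj_on f {0..<Suc n}"
    by (rule inj_onI) (metis ne atLeastLessThan_iff less_Suc_eq_le linorder_neqE_nat)
  then have "distinct ?p" by (simp add: distinct_map del: upt_Suc)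
  moreover have "hd ?p = s" "last ?p = t" using f by (simp_all add: hd_map last_map del: upt_Suc)
  moreover have "successively (\<lambda>u v. {u, v} \<in> B) ?p"
    unfolding successively_conv_nth using f(3) by (auto simp: adj_def simp del: upt_Suc)
  moreover have "set ?p \<subseteq> S" using fS by auto
  ultimately have "graph_path S B s ?p t" by (simp add: graph_path_def del: upt_Suc)
  then show ?thesis by (intro exI[of _ ?p]) auto
qed

lemma graph_dist_relpow:
  assumes "s \<in> S" "t \<in> S"
  shows "(s, t) \<in> adj ^^ d s t"
proof -
  obtain p where p: "graph_path S B s p t"
    using assms connected by (auto simp: connected_graph_def)
  then have "length p = Suc (length p - 1)" by (cases p) (auto simp: graph_path_def)
  then have "\<exists>n p. graph_path S B s p t \<and> length p = Suc n" using p by blast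
  then have "\<exists>p. graph_path S B s p t \<and> length p = Suc (d s t)"
    unfolding graph_dist_def by (rule LeastI_ex)
  then show ?thesis using graph_path_imp_relpow by blast
qed

lemma graph_dist_le:
  assumes "(s, t) \<in> adj ^^ n" "s \<in> S"
  shows "d s t \<le> n"
proof -
  define m where "m = (LEAST m. (s, t) \<in> adj ^^ m)"
  have m: "(s, t) \<in> adj ^^ m" "m \<le> n"
    unfolding m_def using assms(1) by (auto intro: LeastI Least_le)
  have "\<exists>p. graph_path S B s p t \<and> length p = Suc m"
    by (rule minimal_relpow_imp_graph_path[OF m(1) _ assms(2)]) (auto simp: m_def dest: not_less_Least)
  then have "d s t \<le> m" unfolding graph_dist_def by (rule Least_le)
  with m show ?thesis by simp
qed

lemma graph_dist_commute:
  assumes "s \<in> S" "t \<in> S"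
  shows "d s t = d t s"
  using assms by (meson antisym graph_dist_le graph_dist_relpow sym_relpow_adj)

lemma graph_dist_triangle:
  assumes "s \<in> S" "t \<in> S" "u \<in> S"
  shows "d s u \<le> d s t + d t u"
  using assms by (intro graph_dist_le) (auto simp: relpow_add intro: graph_dist_relpow)

lemma graph_dist_self: "s \<in> S \<Longrightarrow> d s s = 0"
  using graph_dist_le[of s s 0] by simp

section \<open>Exponential growth of balls and convergence of exponential sums\<close>

lemma graph_ball_exponential:
  "\<exists>\<theta>\<ge>0. \<forall>s\<in>S. \<forall>n. finite (graph_ball S B n s) \<and>
     real (card (graph_ball S B n s)) \<le> exp (\<theta> * real n)"
proof -
  obtain D where D: "\<And>s. s \<in> S \<Longrightarrow> finite {t\<in>S. {s, t} \<in> B} \<and> card {t\<in>S. {s, t} \<in> B} \<le> D"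
    using degree by (auto simp: bounded_degree_def)
  \<comment> \<open>Raising the radius by one adds at most \<open>D\<close> neighbours for each
    point, so the size grows by a factor of at most \<open>D + 1\<close>. The exponent
    \<open>ln (D + 1)\<close> is therefore admissible, and the set whose infimum is the growth rate
    is not empty.\<close>
  have ball: "finite (graph_ball S B n s) \<and> card (graph_ball S B n s) \<le> (D + 1) ^ n" if "s \<in> S" for n s
  proof (induction n)
    case 0
    have "graph_ball S B 0 s \<subseteq> {s}"
      using that graph_dist_relpow[OF that] by (fastforce simp: graph_ball_def)
    then show ?case by (simp add: finite_subset card_mono[of "{s}", simplified])
  next
    case (Suc n)
    let ?N = "\<lambda>u. insert u {t\<in>S. {u, t} \<in> B}"
    have sub: "graph_ball S B (Suc n) s \<subseteq> (\<Union>u\<in>graph_ball S B n s. ?N u)"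
    proof
      fix t assume t: "t \<in> graph_ball S B (Suc n) s"
      then have tS: "t \<in> S" and le: "d s t \<le> Suc n" by (auto simp: graph_ball_def)
      show "t \<in> (\<Union>u\<in>graph_ball S B n s. ?N u)"
      proof (cases "d s t \<le> n")
        case True
        with tS show ?thesis by (auto simp: graph_ball_def)
      next
        case False
        with le have "(s, t) \<in> adj ^^ Suc n" using graph_dist_relpow[OF that tS] by (simp add: le_Suc_eq)
        then obtain u where u: "(s, u) \<in> adj ^^ n" "(u, t) \<in> adj" by auto
        then have "u \<in> graph_ball S B n s"
          using graph_dist_le[OF u(1) that] adj_in_S by (auto simp: graph_ball_def)
        with u tS show ?thesis by (auto simp: adj_def)
      qed
    qed
    have ballS: "graph_ball S B n s \<subseteq> S" by (auto simp: graph_ball_def)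
    have fin: "finite (\<Union>u\<in>graph_ball S B n s. ?N u)" using Suc D ballS by auto
    have "card (graph_ball S B (Suc n) s) \<le> card (\<Union>u\<in>graph_ball S B n s. ?N u)"
      by (rule card_mono[OF fin sub])
    also have "\<dots> \<le> (\<Sum>u\<in>graph_ball S B n s. card (?N u))"
      by (rule card_UN_le) (use Suc in auto)
    also have "\<dots> \<le> (\<Sum>u\<in>graph_ball S B n s. D + 1)"
    proof (rule sum_mono)
      fix u assume "u \<in> graph_ball S B n s"
      then have "u \<in> S" using ballS by auto
      have "card (?N u) \<le> Suc (card {t\<in>S. {u, t} \<in> B})" using card_insert_le_m1 D \<open>u \<in> S\<close> by (simp add: card_insert_if)
      with D[OF \<open>u \<in> S\<close>] show "card (?N u) \<le> D + 1" by simp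
    qed
    also have "\<dots> \<le> (D + 1) ^ n * (D + 1)" using Suc by (simp del: add_Suc_right)
    also have "\<dots> = (D + 1) ^ Suc n" by simp
    finally show ?case using finite_subset[OF sub fin] by blast
  qed
  show ?thesis
  proof (intro exI[of _ "ln (real D + 1)"] conjI ballI allI)
    fix s n assume "s \<in> S"
    show "finite (graph_ball S B n s)" using ball[OF \<open>s \<in> S\<close>] by blast
    have "real (card (graph_ball S B n s)) \<le> real ((D + 1) ^ n)" using ball[OF \<open>s \<in> S\<close>] of_nat_le_iff by blast
    also have "\<dots> = exp (real n * ln (real D + 1))"
      by (subst exp_of_nat_mult) (simp add: exp_ln_iff add.commute)
    finally show "real (card (graph_ball S B n s)) \<le> exp (ln (real D + 1) * real n)"
      by (simp add: mult.commute)
  qed simp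
qed

lemma finite_graph_ball: "s \<in> S \<Longrightarrow> finite (graph_ball S B n s)"
  using graph_ball_exponential by blast

lemma growth_rate_nonneg: "growth_rate S B \<ge> 0"
  unfolding growth_rate_def using graph_ball_exponential by (intro cInf_greatest) auto

text \<open>The infimum defining the growth rate is itself admissible: for fixed \<open>s\<close>
  and \<open>n \<ge> 1\<close>, the number ln |B_n(s)| / n is a lower bound of all admissible
  exponents. Radius 0, which the definition leaves out, is treated by hand, the ball being a
  singleton.\<close>

lemma card_graph_ball_le:
  assumes "s \<in> S"
  shows "real (card (graph_ball S B n s)) \<le> exp (growth_rate S B * real n)"
proof (cases "n = 0")
  case True
  have "graph_ball S B 0 s \<subseteq> {s}"
    using assms graph_dist_relpow[OF assms] by (fastforce simp: graph_ball_def)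
  then have "card (graph_ball S B 0 s) \<le> card {s}" by (intro card_mono) auto
  with True show ?thesis by simp
next
  case False
  let ?T = "{\<theta>'. \<theta>' \<ge> 0 \<and> (\<forall>s\<in>S. \<forall>n\<ge>1. real (card (graph_ball S B n s)) \<le> exp (\<theta>' * real n))}"
  have pos: "card (graph_ball S B n s) > 0"
    using finite_graph_ball[OF assms] graph_dist_self[OF assms] assms
    by (auto simp: card_gt_0_iff graph_ball_def)
  have "ln (real (card (graph_ball S B n s))) / real n \<le> Inf ?T"
  proof (rule cInf_greatest)
    show "?T \<noteq> {}" using graph_ball_exponential by auto
    fix x assume "x \<in> ?T"
    then have "real (card (graph_ball S B n s)) \<le> exp (x * real n)" using assms False by auto
    then have "ln (real (card (graph_ball S B n s))) \<le> x * real n"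
      using pos by (metis exp_gt_zero ln_exp ln_le_cancel_iff of_nat_0_less_iff)
    with False show "ln (real (card (graph_ball S B n s))) / real n \<le> x" by (simp add: divide_le_eq)
  qed
  then have "ln (real (card (graph_ball S B n s))) \<le> growth_rate S B * real n"
    using False by (simp add: growth_rate_def divide_le_eq)
  then have "exp (ln (real (card (graph_ball S B n s)))) \<le> exp (growth_rate S B * real n)" by simp
  with pos show ?thesis by simp
qed

text \<open>The sphere of radius \<open>n\<close> around \<open>t\<close> lies in the ball, so it
  has at most e^(gn) points, where g is the growth rate. Summing over spheres leaves a geometric
  series with ratio e^(g-b) < 1. The bound does not depend on \<open>t\<close> or
  \<open>W\<close>.\<close>

lemma sum_exp_dist_le:
  assumes "t \<in> S" "finite W" "W \<subseteq> S" and b: "b > growth_rate S B"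
  shows "(\<Sum>w\<in>W. exp (- b * real (d t w))) \<le> 1 / (1 - exp (growth_rate S B - b))"
proof -
  let ?g = "growth_rate S B" and ?q = "exp (growth_rate S B - b)"
  define N where "N = Suc (Max (insert 0 (d t ` W)))"
  have N: "d t w < N" if "w \<in> W" for w
    using that assms(2) by (auto simp: N_def less_Suc_eq_le)
  have "(\<Sum>w\<in>W. exp (- b * real (d t w))) = (\<Sum>n<N. \<Sum>w\<in>{w\<in>W. d t w = n}. exp (- b * real (d t w)))"
    using assms(2) N by (intro sum.group[symmetric]) auto
  also have "\<dots> = (\<Sum>n<N. real (card {w\<in>W. d t w = n}) * exp (- b * real n))"
    by (intro sum.cong) auto
  also have "\<dots> \<le> (\<Sum>n<N. exp (?g * real n) * exp (- b * real n))"
  proof (intro sum_mono mult_right_mono)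
    fix n
    have "{w\<in>W. d t w = n} \<subseteq> graph_ball S B n t" using assms(3) by (auto simp: graph_ball_def)
    then have "card {w\<in>W. d t w = n} \<le> card (graph_ball S B n t)"
      using finite_graph_ball[OF assms(1)] by (intro card_mono)
    with card_graph_ball_le[OF assms(1), of n] show "real (card {w\<in>W. d t w = n}) \<le> exp (?g * real n)"
      by linarith
  qed simp
  also have "\<dots> = (\<Sum>n<N. ?q ^ n)"
    by (intro sum.cong refl) (simp add: exp_of_nat_mult[symmetric] exp_add[symmetric] algebra_simps)
  also have "\<dots> \<le> (\<Sum>n. ?q ^ n)"
    using b by (intro sum_le_suminf summable_geometric) auto
  also have "\<dots> = 1 / (1 - ?q)" using b by (intro suminf_geometric) auto
  finally show ?thesis .
qed

section \<open>Sets separating two sets of sites halfway\<close>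

text \<open>Radius half the distance to \<open>V\<close> keeps the \<open>k\<close>-boundary far from both \<open>U\<close> and \<open>V\<close>, while for
  nonempty \<open>V\<close> and finite \<open>U\<close> the set stays finite, unlike the set of points closer to \<open>U\<close> than to \<open>V\<close>.\<close>

definition separating_set :: "'s set \<Rightarrow> 's set \<Rightarrow> 's set" where
  "separating_set U V = (\<Union>t\<in>U. {s\<in>S. \<forall>v\<in>V. 2 * d t s \<le> d t v})"

text \<open>Infima of nonempty sets in \<open>enat\<close> are attained by well-ordering; for empty
  \<open>D\<close> the infimum is infinite and both sides are false.\<close>

lemma graph_setdist_le_iff:
  "graph_setdist S B s D \<le> enat k \<longleftrightarrow> (\<exists>t\<in>D. d s t \<le> k)"
proof
  assume *: "graph_setdist S B s D \<le> enat k"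
  then obtain t where t: "t \<in> D" by (fastforce simp: graph_setdist_def top_enat_def)
  have "(LEAST x. x \<in> (\<lambda>t. enat (d s t)) ` D) \<in> (\<lambda>t. enat (d s t)) ` D"
    by (rule LeastI[of _ "enat (d s t)"]) (use t in blast)
  then have "Inf ((\<lambda>t. enat (d s t)) ` D) \<in> (\<lambda>t. enat (d s t)) ` D"
    using t unfolding Inf_enat_def by auto
  with * show "\<exists>t\<in>D. d s t \<le> k" by (auto simp: graph_setdist_def)
next
  assume "\<exists>t\<in>D. d s t \<le> k"
  then show "graph_setdist S B s D \<le> enat k"
    unfolding graph_setdist_def by (meson INF_lower2 enat_ord_simps(1))
qed

lemma finite_separating_set:
  assumes "finite U" "U \<subseteq> S" "V \<noteq> {}"
  shows "finite (separating_set U V)"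
proof -
  obtain v where v: "v \<in> V" using assms by auto
  have "separating_set U V \<subseteq> (\<Union>t\<in>U. graph_ball S B (d t v) t)"
  proof
    fix s assume "s \<in> separating_set U V"
    then obtain t where "t \<in> U" "s \<in> S" "2 * d t s \<le> d t v"
      using v by (auto simp: separating_set_def)
    then show "s \<in> (\<Union>t\<in>U. graph_ball S B (d t v) t)"
      by (intro UN_I[of t]) (auto simp: graph_ball_def)
  qed
  moreover have "finite (\<Union>t\<in>U. graph_ball S B (d t v) t)"
    using assms finite_graph_ball by blast
  ultimately show ?thesis by (rule finite_subset)
qed

lemma finite_boundary:
  assumes "finite D" "D \<subseteq> S"
  shows "finite (boundary S B k D)"
proof -
  have "boundary S B k D \<subseteq> (\<Union>t\<in>D. graph_ball S B k t)"
    using assms graph_dist_commute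
    by (fastforce simp: boundary_def graph_setdist_le_iff graph_ball_def)
  moreover have "finite (\<Union>t\<in>D. graph_ball S B k t)"
    using assms finite_graph_ball by blast
  ultimately show ?thesis by (rule finite_subset)
qed

lemma subset_separating_set: "U \<subseteq> S \<Longrightarrow> U \<subseteq> separating_set U V"
  using graph_dist_self by (force simp: separating_set_def)

lemma separating_set_subset: "separating_set U V \<subseteq> S"
  by (auto simp: separating_set_def)

lemma separating_set_disjoint:
  assumes "U \<inter> V = {}" "U \<subseteq> S" "V \<subseteq> S"
  shows "separating_set U V \<inter> V = {}"
proof (rule ccontr)
  assume "separating_set U V \<inter> V \<noteq> {}"
  then obtain v where v: "v \<in> V" "v \<in> separating_set U V" by blast
  then obtain t where "t \<in> U" "2 * d t v \<le> d t v" by (auto simp: separating_set_def)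
  with v have "t \<in> U" "v \<in> V" "d t v = 0" by auto
  then have "t = v" using graph_dist_relpow[of t v] \<open>t \<in> U\<close> \<open>v \<in> V\<close> assms by auto
  with assms \<open>t \<in> U\<close> \<open>v \<in> V\<close> show False by auto
qed

lemma boundary_far_from_left:
  assumes "w \<in> boundary S B k (separating_set U V)" "t \<in> U"
  shows "\<exists>v\<in>V. d t v \<le> 2 * d t w"
proof -
  have "w \<in> S" "w \<notin> separating_set U V" using assms by (auto simp: boundary_def)
  with assms(2) obtain v where "v \<in> V" "\<not> 2 * d t w \<le> d t v"
    unfolding separating_set_def by blast
  then show ?thesis by (intro bexI[of _ v]) auto
qed

text \<open>Take \<open>s\<close> in the separating set within \<open>k\<close> of \<open>w\<close>,
  and \<open>t \<in> U\<close> with \<open>2 * d t s \<le> d t v\<close>. The triangle inequality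
  along t, s, w, v gives d(t,v) \<le> d(t,v)/2 + k + d(v,w). The point \<open>t\<close> may depend
  on \<open>v\<close> and \<open>w\<close>, which is harmless because only the distance from
  \<open>v\<close> to \<open>U\<close> is used later.\<close>

lemma boundary_far_from_right:
  assumes "w \<in> boundary S B k (separating_set U V)" "v \<in> V" "U \<subseteq> S" "V \<subseteq> S" "U \<noteq> {}"
  shows "\<exists>t\<in>U. d t v \<le> 2 * d v w + 2 * k"
proof -
  obtain s where s: "s \<in> separating_set U V" "d w s \<le> k" and wS: "w \<in> S"
    using assms(1) by (auto simp: boundary_def graph_setdist_le_iff)
  then obtain t where t: "t \<in> U" "2 * d t s \<le> d t v" "s \<in> S"
    using assms(2) by (auto simp: separating_set_def)
  have "d t v \<le> d t s + d s v" "d s v \<le> d s w + d w v"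
    using assms t wS by (auto intro!: graph_dist_triangle)
  moreover have "d s w = d w s" "d w v = d v w"
    using graph_dist_commute t(3) wS assms(2,4) by (auto dest: subsetD)
  ultimately have "d t v \<le> 2 * d v w + 2 * k" using t s by linarith
  with t show ?thesis by blast
qed

end

section \<open>Local algebras and cylinders\<close>

lemma space_local_algebra [simp]: "space (local_algebra S E U) = config_space S E"
  by (auto simp: local_algebra_def space_measure_of_conv)

lemma sets_local_algebra:
  "sets (local_algebra S E U) =
     sigma_sets (config_space S E) {{\<omega> \<in> config_space S E. \<omega> s \<in> X} | s X. s \<in> U \<and> X \<subseteq> E}"
  unfolding local_algebra_def by (rule sets_measure_of) auto

lemma sets_local_algebra_mono:
  "U \<subseteq> V \<Longrightarrow> sets (local_algebra S E U) \<subseteq> sets (local_algebra S E V)"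
  unfolding sets_local_algebra by (rule sigma_sets_mono') blast

lemma sets_local_algebra_empty:
  "sets (local_algebra S E {}) = {{}, config_space S E}"
  unfolding sets_local_algebra by (simp add: sigma_sets_empty_eq)

lemma sets_config_borel:
  "sets (config_borel S E) =
     sigma_sets (config_space S E) {U. openin (product_topology (\<lambda>_. discrete_topology E) S) U}"
proof -
  have "U \<subseteq> config_space S E" if "openin (product_topology (\<lambda>_. discrete_topology E) S) U" for U
    using openin_subset[OF that] by (simp add: config_space_def)
  then show ?thesis unfolding config_borel_def by (intro sets_measure_of) auto
qed

lemma space_config_borel [simp]: "space (config_borel S E) = config_space S E"
  by (auto simp: config_borel_def space_measure_of_conv)

lemma sets_local_algebra_subset_config_borel:
  assumes "U \<subseteq> S"
  shows "sets (local_algebra S E U) \<subseteq> sets (config_borel S E)"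
  unfolding sets_local_algebra sets_config_borel
proof (rule sigma_sets_mono', clarify)
  fix s X assume "s \<in> U" "X \<subseteq> E"
  have "continuous_map (product_topology (\<lambda>_. discrete_topology E) S) (discrete_topology E) (\<lambda>\<omega>. \<omega> s)"
    using \<open>s \<in> U\<close> assms by (intro continuous_map_product_projection) auto
  then have "openin (product_topology (\<lambda>_. discrete_topology E) S)
      {\<omega> \<in> topspace (product_topology (\<lambda>_. discrete_topology E) S). \<omega> s \<in> X}"
    using \<open>X \<subseteq> E\<close> by (intro openin_continuous_map_preimage) auto
  then show "openin (product_topology (\<lambda>_. discrete_topology E) S) {\<omega> \<in> config_space S E. \<omega> s \<in> X}"
    by (simp add: config_space_def)
qed

definition cylinder :: "'s set \<Rightarrow> 'e set \<Rightarrow> 's set \<Rightarrow> ('s \<Rightarrow> 'e) \<Rightarrow> ('s \<Rightarrow> 'e) set" where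
  "cylinder S E W w = {\<omega> \<in> config_space S E. \<forall>s\<in>W. \<omega> s = w s}"

lemma cylinder_in_local_algebra:
  assumes "finite W" "W \<subseteq> S"
  shows "cylinder S E W w \<in> sets (local_algebra S E W)"
proof -
  have eq: "cylinder S E W w =
      {\<omega> \<in> space (local_algebra S E W). \<forall>s\<in>W. \<omega> \<in> {\<omega> \<in> config_space S E. \<omega> s \<in> {w s} \<inter> E}}"
    using assms by (auto simp: cylinder_def config_space_def PiE_iff)
  have "{\<omega> \<in> config_space S E. \<omega> s \<in> {w s} \<inter> E} \<in> sets (local_algebra S E W)" if "s \<in> W" for s
    unfolding sets_local_algebra using that by blast
  then show ?thesis unfolding eq using assms(1)
    by (intro sets.sets_Collect_finite_All) (auto simp: Int_def)
qed

lemma disjoint_cylinders: "disjoint_family_on (cylinder S E W) (\<Pi>\<^sub>E s\<in>W. E)"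
proof (unfold disjoint_family_on_def, intro ballI impI)
  fix u v assume uv: "u \<in> (\<Pi>\<^sub>E s\<in>W. E)" "v \<in> (\<Pi>\<^sub>E s\<in>W. E)" "u \<noteq> v"
  then obtain s where "s \<in> W" "u s \<noteq> v s" by (meson PiE_ext)
  then show "cylinder S E W u \<inter> cylinder S E W v = {}" by (fastforce simp: cylinder_def)
qed

lemma Union_cylinders:
  assumes "W \<subseteq> S"
  shows "(\<Union>w\<in>(\<Pi>\<^sub>E s\<in>W. E). cylinder S E W w) = config_space S E"
proof
  show "config_space S E \<subseteq> (\<Union>w\<in>(\<Pi>\<^sub>E s\<in>W. E). cylinder S E W w)"
  proof
    fix \<omega> assume "\<omega> \<in> config_space S E"
    then have "restrict \<omega> W \<in> (\<Pi>\<^sub>E s\<in>W. E)" "\<omega> \<in> cylinder S E W (restrict \<omega> W)"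
      using assms by (auto simp: cylinder_def config_space_def)
    then show "\<omega> \<in> (\<Union>w\<in>(\<Pi>\<^sub>E s\<in>W. E). cylinder S E W w)" by blast
  qed
qed (auto simp: cylinder_def)

text \<open>Events that can be approximated by events on finitely many sites include the generators
  and are closed under complements and countable unions.\<close>

lemma local_algebra_approx:
  assumes "finite_measure M" and sets: "sets M = sets (config_borel S E)" and "U \<subseteq> S"
    and A: "A \<in> sets (local_algebra S E U)" and "\<epsilon> > 0"
  shows "\<exists>F A'. finite F \<and> F \<subseteq> U \<and> A' \<in> sets (local_algebra S E F) \<and> measure M (sym_diff A A') < \<epsilon>"
proof -
  interpret finite_measure M by fact
  let ?\<Omega> = "config_space S E"
  have M: "sets (local_algebra S E F) \<subseteq> sets M" if "F \<subseteq> U" for F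
    using sets_local_algebra_subset_config_borel[of F S E] that assms by auto
  show ?thesis using A[unfolded sets_local_algebra] \<open>\<epsilon> > 0\<close>
  proof (induction arbitrary: \<epsilon> rule: sigma_sets.induct)
    case (Basic a)
    then obtain s X where sX: "s \<in> U" "X \<subseteq> E" "a = {\<omega> \<in> ?\<Omega>. \<omega> s \<in> X}" by auto
    then have "a \<in> sets (local_algebra S E {s})" unfolding sets_local_algebra by blast
    with sX Basic show ?case by (intro exI[of _ "{s}"] exI[of _ a]) auto
  next
    case Empty
    then show ?case by (intro exI[of _ "{}"]) auto
  next
    case (Compl a)
    from Compl.IH[OF Compl.prems] obtain F A' where *: "finite F" "F \<subseteq> U"
      "A' \<in> sets (local_algebra S E F)" "measure M (sym_diff a A') < \<epsilon>" by blast
    have "a \<subseteq> ?\<Omega>" by (rule sigma_sets_into_sp[OF _ Compl.hyps]) auto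
    moreover have "A' \<subseteq> ?\<Omega>" using sets.sets_into_space[OF *(3)] by simp
    ultimately have "sym_diff (?\<Omega> - a) (?\<Omega> - A') = sym_diff a A'" by blast
    moreover have "?\<Omega> - A' \<in> sets (local_algebra S E F)"
      using sets.compl_sets[OF *(3)] by simp
    ultimately show ?case using * by metis
  next
    case (Union a)
    have aM: "a i \<in> sets M" for i
      using Union.hyps M[OF order_refl] by (auto simp: sets_local_algebra)
    \<comment> \<open>Continuity from below allows cutting the union off at \<open>n\<close> at a
      cost of \<epsilon>/2; the other \<epsilon>/2 is shared equally among the \<open>Suc n\<close>
      remaining sets, which determines \<open>\<eta>\<close>.\<close>
    have "(\<lambda>n. measure M (\<Union>i\<le>n. a i)) \<longlonglongrightarrow> measure M (\<Union>n. \<Union>i\<le>n. a i)"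
      using aM by (intro finite_Lim_measure_incseq) (auto simp: incseq_def intro: order_trans)
    moreover have "(\<Union>n. \<Union>i\<le>n. a i) = (\<Union>i. a i)" by auto
    ultimately have "\<forall>\<^sub>F n in sequentially. measure M (\<Union>i\<le>n. a i) > measure M (\<Union>i. a i) - \<epsilon> / 2"
      using Union.prems by (intro order_tendstoD) auto
    then obtain n where n: "measure M (\<Union>i\<le>n. a i) > measure M (\<Union>i. a i) - \<epsilon> / 2"
      by (meson eventually_sequentially order_refl)
    define \<eta> where "\<eta> = \<epsilon> / (2 * real (Suc n))"
    have "\<eta> > 0" using Union.prems by (simp add: \<eta>_def)
    with Union.IH have "\<forall>i. \<exists>F A'. finite F \<and> F \<subseteq> U \<and> A' \<in> sets (local_algebra S E F) \<and>
        measure M (sym_diff (a i) A') < \<eta>" by blast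
    then obtain F A' where FA: "\<And>i. finite (F i)" "\<And>i. F i \<subseteq> U"
      "\<And>i. A' i \<in> sets (local_algebra S E (F i))" "\<And>i. measure M (sym_diff (a i) (A' i)) < \<eta>" by metis
    let ?F = "\<Union>i\<le>n. F i" and ?A = "\<Union>i\<le>n. A' i"
    have AM: "A' i \<in> sets M" for i using FA(2,3) M by blast
    have "A' i \<in> sets (local_algebra S E ?F)" if "i \<le> n" for i
      using FA(3)[of i] sets_local_algebra_mono[of "F i" ?F S E] that by blast
    then have A: "?A \<in> sets (local_algebra S E ?F)" by blast
    have "sym_diff (\<Union>i. a i) ?A \<subseteq> ((\<Union>i. a i) - (\<Union>i\<le>n. a i)) \<union> (\<Union>i\<le>n. sym_diff (a i) (A' i))"
      by blast
    then have "measure M (sym_diff (\<Union>i. a i) ?A) \<le>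
        measure M (((\<Union>i. a i) - (\<Union>i\<le>n. a i)) \<union> (\<Union>i\<le>n. sym_diff (a i) (A' i)))"
      using aM AM by (intro finite_measure_mono) auto
    also have "\<dots> \<le> measure M ((\<Union>i. a i) - (\<Union>i\<le>n. a i)) + measure M (\<Union>i\<le>n. sym_diff (a i) (A' i))"
      using aM AM by (intro measure_Un_le) auto
    also have "measure M (\<Union>i\<le>n. sym_diff (a i) (A' i)) \<le> (\<Sum>i\<le>n. measure M (sym_diff (a i) (A' i)))"
      using aM AM by (intro measure_UNION_le) auto
    also have "\<dots> \<le> (\<Sum>i\<le>n. \<eta>)" using FA(4) by (intro sum_mono less_imp_le)
    also have "\<dots> = \<epsilon> / 2" by (simp add: \<eta>_def field_simps)
    also have "measure M ((\<Union>i. a i) - (\<Union>i\<le>n. a i)) = measure M (\<Union>i. a i) - measure M (\<Union>i\<le>n. a i)"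
      using aM by (intro finite_measure_Diff) auto
    finally have "measure M (sym_diff (\<Union>i. a i) ?A) < \<epsilon>" using n by linarith
    moreover have "finite ?F" "?F \<subseteq> U" using FA by auto
    ultimately show ?case using A by blast
  qed
qed

lemma (in finite_measure) measure_diff_le_sym_diff:
  assumes "A \<in> sets M" "A' \<in> sets M" "Q \<in> sets M"
  shows "\<bar>measure M (A \<inter> Q) - measure M (A' \<inter> Q)\<bar> \<le> measure M (sym_diff A A')"
proof -
  have *: "measure M (X \<inter> Q) \<le> measure M (Y \<inter> Q) + measure M (sym_diff X Y)"
    if "X \<in> sets M" "Y \<in> sets M" for X Y
  proof -
    have "measure M (X \<inter> Q) \<le> measure M ((Y \<inter> Q) \<union> sym_diff X Y)"
      using that assms by (intro finite_measure_mono) auto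
    also have "\<dots> \<le> measure M (Y \<inter> Q) + measure M (sym_diff X Y)"
      using that assms by (intro measure_Un_le) auto
    finally show ?thesis .
  qed
  from *[OF assms(1,2)] *[OF assms(2,1)] show ?thesis by (simp add: Un_commute)
qed

text \<open>Both sides depend continuously on \<open>A\<close> with respect to the measure of
  symmetric differences, so the bound extends from events on finitely many sites to all events of
  \<open>U\<close>.\<close>

lemma ratio_bound_local:
  assumes "prob_space M" and sets: "sets M = sets (config_borel S E)" and "U \<subseteq> S"
    and Q: "Q \<in> sets M" and "\<delta> \<ge> 0"
    and fin: "\<And>F A. finite F \<Longrightarrow> F \<subseteq> U \<Longrightarrow> A \<in> sets (local_algebra S E F) \<Longrightarrow>
      \<bar>measure M (A \<inter> Q) - measure M A * measure M Q\<bar> \<le> \<delta> * (measure M A * measure M Q)"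
    and A: "A \<in> sets (local_algebra S E U)"
  shows "\<bar>measure M (A \<inter> Q) - measure M A * measure M Q\<bar> \<le> \<delta> * (measure M A * measure M Q)"
proof (rule field_le_epsilon)
  interpret prob_space M by fact
  have sub: "sets (local_algebra S E F) \<subseteq> sets M" if "F \<subseteq> U" for F
    using sets_local_algebra_subset_config_borel[of F S E] that assms by auto
  fix e :: real assume "e > 0"
  \<comment> \<open>Replacing \<open>A\<close> by \<open>A'\<close> costs at most
    \<open>\<eta>\<close> in each of the two terms on the left and \<open>\<delta> * \<eta>\<close>
    on the right.\<close>
  define \<eta> where "\<eta> = e / (2 + \<delta>)"
  have "\<eta> > 0" using \<open>e > 0\<close> \<open>\<delta> \<ge> 0\<close> by (simp add: \<eta>_def)
  from local_algebra_approx[OF finite_measure_axioms sets \<open>U \<subseteq> S\<close> A this]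
  obtain F A' where F: "finite F" "F \<subseteq> U" "A' \<in> sets (local_algebra S E F)" "measure M (sym_diff A A') < \<eta>"
    by blast
  have AM: "A \<in> sets M" "A' \<in> sets M" using A F sub by auto
  have 1: "\<bar>measure M (A \<inter> Q) - measure M (A' \<inter> Q)\<bar> \<le> \<eta>"
    using measure_diff_le_sym_diff[OF AM Q] F by linarith
  have 2: "\<bar>measure M A - measure M A'\<bar> \<le> \<eta>"
    using measure_diff_le_sym_diff[OF AM sets.top] F AM by simp
  have "\<bar>measure M A * measure M Q - measure M A' * measure M Q\<bar> = \<bar>measure M A - measure M A'\<bar> * measure M Q"
    by (simp add: left_diff_distrib[symmetric] abs_mult)
  also have "\<dots> \<le> \<eta> * 1" using 2 by (intro mult_mono) auto
  finally have 3: "\<bar>measure M A * measure M Q - measure M A' * measure M Q\<bar> \<le> \<eta>" by simp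
  have "\<delta> * (measure M A' * measure M Q) \<le> \<delta> * (measure M A * measure M Q + \<eta>)"
    using 3 \<open>\<delta> \<ge> 0\<close> by (intro mult_left_mono) linarith+
  then have "\<bar>measure M (A \<inter> Q) - measure M A * measure M Q\<bar> \<le> \<delta> * (measure M A * measure M Q) + (2 + \<delta>) * \<eta>"
    using 1 3 fin[OF F(1-3)] by (simp add: algebra_simps)
  also have "(2 + \<delta>) * \<eta> = e" using \<open>\<delta> \<ge> 0\<close> by (simp add: \<eta>_def)
  finally show "\<bar>measure M (A \<inter> Q) - measure M A * measure M Q\<bar> \<le> \<delta> * (measure M A * measure M Q) + e" .
qed

section \<open>Conditional independence and mixing\<close>

text \<open>Up to a null set, the conditional probability of \<open>A\<close> given the outside of
  \<open>D\<close> is constant on \<open>P\<close>, because \<open>P\<close> fixes the configuration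
  on the boundary of \<open>D\<close>. Integrating it over \<open>P\<close> and over
  \<open>P \<inter> Q\<close> and eliminating the constant gives the identity, which stays free of
  division and so also covers null cells.\<close>

lemma markovian_cond_indep:
  assumes "prob_space \<mu>" and sets: "sets \<mu> = sets (config_borel S E)"
    and rcp: "regular_cond_probs S E \<mu> \<kappa>" and mk: "markovian S B k \<mu> \<kappa>"
    and D: "finite D" "D \<subseteq> S" and W: "W = boundary S B k D" "finite W"
    and A: "A \<in> sets (local_algebra S E D)" and Q: "Q \<in> sets (local_algebra S E (S - D))"
    and P: "P = cylinder S E W w"
  shows "measure \<mu> (A \<inter> P \<inter> Q) * measure \<mu> P = measure \<mu> (A \<inter> P) * measure \<mu> (P \<inter> Q)"
proof -
  interpret prob_space \<mu> by fact
  let ?F = "local_algebra S E (S - D)"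
  have space: "space \<mu> = config_space S E" using sets_eq_imp_space_eq[OF sets] by simp
  have sub: "sets (local_algebra S E U) \<subseteq> sets \<mu>" if "U \<subseteq> S" for U
    using sets_local_algebra_subset_config_borel[OF that, of E] sets by simp
  have alg: "subalgebra \<mu> ?F" using sub space by (auto simp: subalgebra_def)
  interpret F: finite_measure_subalgebra \<mu> ?F by unfold_locales (rule alg)
  have WD: "W \<subseteq> S - D" using W by (auto simp: boundary_def)
  then have "P \<in> sets (local_algebra S E W)" unfolding P using W by (intro cylinder_in_local_algebra) auto
  then have PF: "P \<in> sets ?F" using sets_local_algebra_mono[OF WD] by blast
  have AM: "A \<in> sets \<mu>" using A sub D by auto
  have PM: "P \<in> sets \<mu>" using PF sub[of "S - D"] by auto
  obtain \<Omega>' where \<Omega>': "\<Omega>' \<in> sets \<mu>" "prob \<Omega>' = 1"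
    "\<And>\<omega> \<tau>. \<omega> \<in> \<Omega>' \<Longrightarrow> \<tau> \<in> \<Omega>' \<Longrightarrow> restrict \<omega> W = restrict \<tau> W \<Longrightarrow> \<kappa> D \<omega> = \<kappa> D \<tau>"
    using mk D unfolding markovian_def W(1) by metis
  \<comment> \<open>If \<open>\<Omega>' \<inter> P\<close> is empty, any \<open>c\<close> will
    do.\<close>
  obtain c where c: "\<And>\<omega>. \<omega> \<in> \<Omega>' \<inter> P \<Longrightarrow> measure (\<kappa> D \<omega>) A = c"
  proof (cases "\<Omega>' \<inter> P = {}")
    case False
    then obtain \<tau> where \<tau>: "\<tau> \<in> \<Omega>' \<inter> P" by blast
    show ?thesis
    proof (rule that[of "measure (\<kappa> D \<tau>) A"])
      fix \<omega> assume "\<omega> \<in> \<Omega>' \<inter> P"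
      with \<tau> have "restrict \<omega> W = restrict \<tau> W" by (intro restrict_ext) (auto simp: P cylinder_def)
      with \<Omega>'(3)[of \<omega> \<tau>] \<tau> \<open>\<omega> \<in> \<Omega>' \<inter> P\<close> show "measure (\<kappa> D \<omega>) A = measure (\<kappa> D \<tau>) A"
        by auto
    qed
  qed (use that in blast)
  have ae1: "AE \<omega> in \<mu>. \<omega> \<in> \<Omega>'" using \<Omega>' by (simp add: AE_in_set_eq_1)
  have ae2: "AE \<omega> in \<mu>. measure (\<kappa> D \<omega>) A = real_cond_exp \<mu> ?F (indicator A) \<omega>"
    using rcp D A unfolding regular_cond_probs_def by blast
  have key: "prob (A \<inter> G) = c * prob G" if G: "G \<in> sets ?F" "G \<subseteq> P" for G
  proof -
    have GM: "G \<in> sets \<mu>" using G sub[of "S - D"] by auto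
    have "prob (A \<inter> G) = (\<integral>\<omega>\<in>G. indicator A \<omega> \<partial>\<mu>)"
      using AM GM by (simp add: set_lebesgue_integral_def indicator_inter_arith[symmetric] Int_commute)
    also have "\<dots> = (\<integral>\<omega>\<in>G. real_cond_exp \<mu> ?F (indicator A) \<omega> \<partial>\<mu>)"
      using AM G by (intro F.real_cond_exp_intA) (auto simp: integrable_indicator_iff emeasure_eq_measure)
    also have "\<dots> = (\<integral>\<omega>\<in>G. c \<partial>\<mu>)"
      unfolding set_lebesgue_integral_def
    proof (rule integral_cong_AE)
      show "AE \<omega> in \<mu>. indicator G \<omega> *\<^sub>R real_cond_exp \<mu> ?F (indicator A) \<omega> = indicator G \<omega> *\<^sub>R c"
        using ae1 ae2 by eventually_elim (use G c in \<open>auto simp: indicator_def split: if_splits\<close>)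
    qed (use GM in measurable)
    also have "\<dots> = c * prob G" using GM by (simp add: set_lebesgue_integral_def mult.commute)
    finally show ?thesis .
  qed
  have "A \<inter> P \<inter> Q = A \<inter> (P \<inter> Q)" by blast
  then have "prob (A \<inter> P \<inter> Q) = c * prob (P \<inter> Q)" using key[of "P \<inter> Q"] PF Q by auto
  moreover have "prob (A \<inter> P) = c * prob P" using key[of P] PF by auto
  ultimately show ?thesis by simp
qed

text \<open>Multiplying by the probability of the conditioning event \<open>Q\<close> extends the
  bound to null events, over which the supremum does not range.\<close>

lemma phi_coeffD:
  assumes "prob_space \<mu>" "space \<mu> = config_space S E"
    and phi: "phi_coeff S E \<mu> U V \<le> ennreal \<epsilon>" and "\<epsilon> \<ge> 0"
    and A: "A \<in> sets (local_algebra S E U)" and Q: "Q \<in> sets (local_algebra S E V)"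
    and sub: "sets (local_algebra S E U) \<subseteq> sets \<mu>" "sets (local_algebra S E V) \<subseteq> sets \<mu>"
  shows "\<bar>measure \<mu> (Q \<inter> A) - measure \<mu> Q * measure \<mu> A\<bar> \<le> \<epsilon> * measure \<mu> Q"
proof -
  interpret prob_space \<mu> by fact
  have AM: "A \<in> sets \<mu>" "Q \<in> sets \<mu>" using A Q sub by auto
  show ?thesis
  proof (cases "prob A > 0 \<and> prob Q > 0")
    case True
    have sp: "A \<subseteq> space \<mu>" "Q \<subseteq> space \<mu>" using AM sets.sets_into_space by auto
    then have "{\<omega> \<in> space \<mu>. \<omega> \<in> A \<and> \<omega> \<in> Q} = Q \<inter> A" "{\<omega> \<in> space \<mu>. \<omega> \<in> Q} = Q" by auto
    then have "cond_prob \<mu> (\<lambda>\<omega>. \<omega> \<in> A) (\<lambda>\<omega>. \<omega> \<in> Q) = prob (Q \<inter> A) / prob Q"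
      by (simp add: cond_prob_def)
    moreover have "ennreal \<bar>cond_prob \<mu> (\<lambda>\<omega>. \<omega> \<in> A) (\<lambda>\<omega>. \<omega> \<in> Q) - prob A\<bar> \<le> phi_coeff S E \<mu> U V"
      unfolding phi_coeff_def using True A Q by (intro Sup_upper) blast
    ultimately have "\<bar>prob (Q \<inter> A) / prob Q - prob A\<bar> \<le> \<epsilon>"
      using phi \<open>\<epsilon> \<ge> 0\<close> by (metis ennreal_le_iff order_trans)
    then have "\<bar>prob (Q \<inter> A) / prob Q - prob A\<bar> * prob Q \<le> \<epsilon> * prob Q"
      using True by (intro mult_right_mono) auto
    moreover have "\<bar>prob (Q \<inter> A) / prob Q - prob A\<bar> * prob Q = \<bar>(prob (Q \<inter> A) / prob Q - prob A) * prob Q\<bar>"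
      by (simp add: abs_mult)
    moreover have "(prob (Q \<inter> A) / prob Q - prob A) * prob Q = prob (Q \<inter> A) - prob Q * prob A"
      using True by (simp add: field_simps)
    ultimately show ?thesis by simp
  next
    case False
    then have "prob A = 0 \<or> prob Q = 0" by (auto simp: zero_less_measure_iff)
    moreover have "prob (Q \<inter> A) \<le> prob Q" "prob (Q \<inter> A) \<le> prob A"
      using AM by (auto intro: finite_measure_mono)
    ultimately show ?thesis using \<open>\<epsilon> \<ge> 0\<close>
      by (auto simp: measure_le_0_iff)
  qed
qed

text \<open>The bad cells are split by the sign of their deviation. Within one sign the deviations
  add up without cancellation, so \<open>mix\<close>, applied to the union of these cells, bounds
  their total probability by \<epsilon>/\<delta>; the two signs give the factor 2.\<close>

lemma (in prob_space) bad_cells_small: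
  assumes I: "finite I" and P: "\<And>i. i \<in> I \<Longrightarrow> P i \<in> events" "disjoint_family_on P I"
    and Q: "Q \<in> events" and "\<delta> > 0"
    and mix: "\<And>J. J \<subseteq> I \<Longrightarrow> \<bar>prob (Q \<inter> (\<Union>i\<in>J. P i)) - prob Q * prob (\<Union>i\<in>J. P i)\<bar> \<le> \<epsilon> * prob Q"
    and J: "J = {i\<in>I. \<bar>prob (Q \<inter> P i) - prob Q * prob (P i)\<bar> > \<delta> * (prob Q * prob (P i))}"
    and "\<epsilon> \<ge> 0"
  shows "(\<Sum>i\<in>J. prob (P i)) \<le> 2 * \<epsilon> / \<delta>"
proof (cases "prob Q = 0")
  case True
  have "J = {}"
  proof -
    have "prob (Q \<inter> P i) = 0" if "i \<in> I" for i
      using finite_measure_mono[of "Q \<inter> P i" Q] True Q by (auto simp: measure_le_0_iff)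
    then show ?thesis using True J by auto
  qed
  with assms show ?thesis by simp
next
  case False
  then have Qpos: "prob Q > 0" by (simp add: zero_less_measure_iff)
  have sums: "prob (\<Union>i\<in>K. P i) = (\<Sum>i\<in>K. prob (P i))"
    "prob (Q \<inter> (\<Union>i\<in>K. P i)) = (\<Sum>i\<in>K. prob (Q \<inter> P i))" if "K \<subseteq> I" for K
  proof -
    have fin: "finite K" using that I finite_subset by blast
    have disj: "disjoint_family_on P K" using P(2) that by (rule disjoint_family_on_mono[rotated])
    show "prob (\<Union>i\<in>K. P i) = (\<Sum>i\<in>K. prob (P i))"
      using fin disj P(1) that by (intro finite_measure_finite_Union) auto
    have "prob (\<Union>i\<in>K. Q \<inter> P i) = (\<Sum>i\<in>K. prob (Q \<inter> P i))"
      using fin disj P(1) that Q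
      by (intro finite_measure_finite_Union) (auto simp: disjoint_family_on_def)
    then show "prob (Q \<inter> (\<Union>i\<in>K. P i)) = (\<Sum>i\<in>K. prob (Q \<inter> P i))"
      by (simp only: Int_UN_distrib)
  qed
  \<comment> \<open>The number \<open>s\<close> is the common sign of the deviations on
    \<open>K\<close>.\<close>
  have half: "(\<Sum>i\<in>K. prob (P i)) \<le> \<epsilon> / \<delta>"
    if K: "K \<subseteq> I" and "\<bar>s\<bar> = 1" and
      big: "\<And>i. i \<in> K \<Longrightarrow> \<delta> * (prob Q * prob (P i)) \<le> s * (prob (Q \<inter> P i) - prob Q * prob (P i))"
    for K and s :: real
  proof -
    have "\<delta> * (prob Q * (\<Sum>i\<in>K. prob (P i))) = (\<Sum>i\<in>K. \<delta> * (prob Q * prob (P i)))"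
      by (simp add: sum_distrib_left)
    also have "\<dots> \<le> (\<Sum>i\<in>K. s * (prob (Q \<inter> P i) - prob Q * prob (P i)))"
      using big by (rule sum_mono)
    also have "\<dots> = s * (prob (Q \<inter> (\<Union>i\<in>K. P i)) - prob Q * prob (\<Union>i\<in>K. P i))"
      unfolding sums[OF K] by (simp add: sum_distrib_left[symmetric] sum_subtractf)
    also have "\<dots> \<le> \<bar>s * (prob (Q \<inter> (\<Union>i\<in>K. P i)) - prob Q * prob (\<Union>i\<in>K. P i))\<bar>" by simp
    also have "\<dots> \<le> \<epsilon> * prob Q" using mix[OF K] \<open>\<bar>s\<bar> = 1\<close> by (simp add: abs_mult)
    finally have "prob Q * (\<delta> * (\<Sum>i\<in>K. prob (P i))) \<le> prob Q * \<epsilon>" by (simp add: algebra_simps)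
    with Qpos \<open>\<delta> > 0\<close> show ?thesis by (simp add: field_simps)
  qed
  let ?g = "\<lambda>i. prob (Q \<inter> P i) - prob Q * prob (P i)" and ?h = "\<lambda>i. \<delta> * (prob Q * prob (P i))"
  have "J \<subseteq> {i\<in>I. ?g i > ?h i} \<union> {i\<in>I. - ?g i > ?h i}" using J by auto
  then have "(\<Sum>i\<in>J. prob (P i)) \<le> (\<Sum>i\<in>{i\<in>I. ?g i > ?h i} \<union> {i\<in>I. - ?g i > ?h i}. prob (P i))"
    using I by (intro sum_mono2) auto
  also have "\<dots> \<le> (\<Sum>i\<in>{i\<in>I. ?g i > ?h i}. prob (P i)) + (\<Sum>i\<in>{i\<in>I. - ?g i > ?h i}. prob (P i))"
    using I by (simp add: sum_Un sum_nonneg)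
  also have "\<dots> \<le> \<epsilon> / \<delta> + \<epsilon> / \<delta>"
    by (intro add_mono half[of _ 1] half[of _ "-1"]) auto
  finally show ?thesis by simp
qed

text \<open>Here \<open>a\<close>, \<open>b\<close>, \<open>c\<close>, \<open>p\<close> stand for
  the probabilities of A, Q, A \<inter> Q and one cell, and \<open>x\<close>, \<open>y\<close>,
  \<open>z\<close> for those of the intersections of the three events with that cell;
  \<open>eq\<close> is conditional independence. Inserting the bounds on \<open>x\<close>,
  \<open>y\<close>, \<open>z\<close> into \<open>eq\<close> traps \<open>c\<close> between
  \<open>a * b\<close> times (1-\<delta>)^2/(1+\<delta>) and \<open>a * b\<close> times
  (1+\<delta>)^2/(1-\<delta>).\<close>

lemma cross_ratio_estimate:
  fixes a b c p x y z \<delta> :: real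
  assumes eq: "z * p = x * y"
    and x: "\<bar>x - a * p\<bar> \<le> \<delta> * (a * p)" and y: "\<bar>y - b * p\<bar> \<le> \<delta> * (b * p)"
    and z: "\<bar>z - c * p\<bar> \<le> \<delta> * (c * p)"
    and nn: "a \<ge> 0" "b \<ge> 0" "c \<ge> 0" "p > 0" "0 \<le> \<delta>" "\<delta> \<le> 1 / 2"
  shows "\<bar>c - a * b\<bar> \<le> 7 * \<delta> * (a * b)"
proof -
  have lo: "(1 - \<delta>) * (a * p) \<le> x" "(1 - \<delta>) * (b * p) \<le> y" "(1 - \<delta>) * (c * p) \<le> z"
    and hi: "x \<le> (1 + \<delta>) * (a * p)" "y \<le> (1 + \<delta>) * (b * p)" "z \<le> (1 + \<delta>) * (c * p)"
    using x y z by (auto simp: algebra_simps abs_le_iff)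
  have pos: "0 \<le> (1 - \<delta>) * (a * p)" "0 \<le> (1 - \<delta>) * (b * p)" using nn by auto
  then have "0 \<le> x" "0 \<le> y" using lo by linarith+
  have "((1 - \<delta>) * (a * p)) * ((1 - \<delta>) * (b * p)) \<le> x * y"
    using lo pos by (intro mult_mono) auto
  also have "\<dots> \<le> ((1 + \<delta>) * (c * p)) * p" using hi nn eq by (metis less_imp_le mult_right_mono)
  finally have "p\<^sup>2 * ((1 - \<delta>)\<^sup>2 * (a * b)) \<le> p\<^sup>2 * ((1 + \<delta>) * c)"
    by (simp add: power2_eq_square algebra_simps)
  then have l: "(1 - \<delta>)\<^sup>2 * (a * b) \<le> (1 + \<delta>) * c" using nn by simp
  have "((1 - \<delta>) * (c * p)) * p \<le> x * y" using lo nn eq by (metis less_imp_le mult_right_mono)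
  also have "\<dots> \<le> ((1 + \<delta>) * (a * p)) * ((1 + \<delta>) * (b * p))"
    using hi \<open>0 \<le> x\<close> \<open>0 \<le> y\<close> by (intro mult_mono) linarith+
  finally have "p\<^sup>2 * ((1 - \<delta>) * c) \<le> p\<^sup>2 * ((1 + \<delta>)\<^sup>2 * (a * b))"
    by (simp add: power2_eq_square algebra_simps)
  then have u: "(1 - \<delta>) * c \<le> (1 + \<delta>)\<^sup>2 * (a * b)" using nn by simp
  have ab: "a * b \<ge> 0" using nn by simp
  \<comment> \<open>After expansion this is 8\<delta>^2 \<le> 4\<delta>, which is the condition
    \<delta> \<le> 1/2; equality at 1/2 explains the constant 7.\<close>
  have "(1 + \<delta>)\<^sup>2 * (a * b) \<le> (1 - \<delta>) * ((1 + 7 * \<delta>) * (a * b))"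
  proof -
    have "\<delta> * \<delta> \<le> \<delta> * (1 / 2)" using nn by (intro mult_left_mono) auto
    then have "(1 + \<delta>)\<^sup>2 \<le> (1 - \<delta>) * (1 + 7 * \<delta>)"
      by (simp add: power2_eq_square algebra_simps)
    from mult_right_mono[OF this ab] show ?thesis by (simp add: mult.assoc)
  qed
  with u have "(1 - \<delta>) * c \<le> (1 - \<delta>) * ((1 + 7 * \<delta>) * (a * b))" by (rule order_trans)
  then have "c \<le> (1 + 7 * \<delta>) * (a * b)" by (rule mult_left_le_imp_le) (use nn in simp)
  moreover have "(1 + \<delta>) * ((1 - 7 * \<delta>) * (a * b)) \<le> (1 - \<delta>)\<^sup>2 * (a * b)"
  proof -
    have "0 \<le> \<delta> * \<delta>" by simp
    then have "(1 + \<delta>) * (1 - 7 * \<delta>) \<le> (1 - \<delta>)\<^sup>2"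
      using nn by (simp add: power2_eq_square algebra_simps)
    from mult_right_mono[OF this ab] show ?thesis by (simp add: mult.assoc)
  qed
  from this l have "(1 + \<delta>) * ((1 - 7 * \<delta>) * (a * b)) \<le> (1 + \<delta>) * c" by (rule order_trans)
  then have "(1 - 7 * \<delta>) * (a * b) \<le> c" by (rule mult_left_le_imp_le) (use nn in simp)
  ultimately show ?thesis by (simp add: algebra_simps abs_le_iff)
qed

lemma (in prob_space) ratio_bound_of_cond_indep:
  assumes I: "finite I" and P: "\<And>i. i \<in> I \<Longrightarrow> P i \<in> events" "disjoint_family_on P I"
    and cover: "(\<Union>i\<in>I. P i) = space M"
    and A: "A \<in> events" and Q: "Q \<in> events" and \<epsilon>: "\<epsilon> > 0" "7 * \<epsilon> \<le> 1 / 2"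
    and mix: "\<And>J R. J \<subseteq> I \<Longrightarrow> R \<in> {A, Q, A \<inter> Q} \<Longrightarrow>
      \<bar>prob (R \<inter> (\<Union>i\<in>J. P i)) - prob R * prob (\<Union>i\<in>J. P i)\<bar> \<le> \<epsilon> * prob R"
    and indep: "\<And>i. i \<in> I \<Longrightarrow> prob (A \<inter> P i \<inter> Q) * prob (P i) = prob (A \<inter> P i) * prob (P i \<inter> Q)"
  shows "\<bar>prob (A \<inter> Q) - prob A * prob Q\<bar> \<le> 49 * \<epsilon> * (prob A * prob Q)"
proof -
  \<comment> \<open>The threshold \<open>7 * \<epsilon>\<close> gives each of the three events bad
    cells of total probability at most 2/7, and 6/7 < 1; a factor 6 would only yield the bound 1.
    The cross-ratio estimate contributes another factor 7, whence 49.\<close>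
  define bad where
    "bad R = {i\<in>I. \<bar>prob (R \<inter> P i) - prob R * prob (P i)\<bar> > 7 * \<epsilon> * (prob R * prob (P i))}" for R
  have small: "(\<Sum>i\<in>bad R. prob (P i)) \<le> 2 / 7" if "R \<in> {A, Q, A \<inter> Q}" for R
  proof -
    have "R \<in> events" using that A Q by auto
    then have "(\<Sum>i\<in>bad R. prob (P i)) \<le> 2 * \<epsilon> / (7 * \<epsilon>)"
      using \<epsilon> mix that by (intro bad_cells_small[OF I P(1) P(2) _ _ _ bad_def]) auto
    with \<epsilon> show ?thesis by simp
  qed
  let ?bad = "bad A \<union> bad Q \<union> bad (A \<inter> Q)"
  have fin: "finite (bad R)" for R using I by (simp add: bad_def)
  have "(\<Sum>i\<in>?bad. prob (P i)) \<le> (\<Sum>i\<in>bad A \<union> bad Q. prob (P i)) + (\<Sum>i\<in>bad (A \<inter> Q). prob (P i))"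
    using fin by (simp add: sum_Un sum_nonneg)
  also have "(\<Sum>i\<in>bad A \<union> bad Q. prob (P i)) \<le> (\<Sum>i\<in>bad A. prob (P i)) + (\<Sum>i\<in>bad Q. prob (P i))"
    using fin by (simp add: sum_Un sum_nonneg)
  finally have bad: "(\<Sum>i\<in>?bad. prob (P i)) < 1"
    using small[of A] small[of Q] small[of "A \<inter> Q"] by simp
  have "(\<Sum>i\<in>I. prob (P i)) = prob (\<Union>i\<in>I. P i)"
    using I P by (intro finite_measure_finite_Union[symmetric]) auto
  then have one: "(\<Sum>i\<in>I. prob (P i)) = 1" by (simp add: cover prob_space)
  \<comment> \<open>Otherwise the bad cells would carry the whole mass 1.\<close>
  have "\<exists>i\<in>I - ?bad. prob (P i) \<noteq> 0"
  proof (rule ccontr)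
    assume no: "\<not> ?thesis"
    have "?bad \<subseteq> I" by (auto simp: bad_def)
    with no have "(\<Sum>i\<in>I. prob (P i)) = (\<Sum>i\<in>?bad. prob (P i))"
      using I by (intro sum.mono_neutral_right) blast+
    with one bad show False by simp
  qed
  then obtain i where i: "i \<in> I" "i \<notin> ?bad" "prob (P i) > 0"
    by (auto simp: zero_less_measure_iff)
  have "\<bar>prob (A \<inter> Q) - prob A * prob Q\<bar> \<le> 7 * (7 * \<epsilon>) * (prob A * prob Q)"
  proof (rule cross_ratio_estimate)
    have "A \<inter> Q \<inter> P i = A \<inter> P i \<inter> Q" "Q \<inter> P i = P i \<inter> Q" by auto
    then show "prob (A \<inter> Q \<inter> P i) * prob (P i) = prob (A \<inter> P i) * prob (Q \<inter> P i)"
      using indep[OF i(1)] by simp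
  qed (use i \<epsilon> in \<open>auto simp: bad_def\<close>)
  then show ?thesis by simp
qed

section \<open>Decay sums\<close>

lemma ennreal_summable_on [simp]: "(f :: _ \<Rightarrow> ennreal) summable_on A"
  by (rule nonneg_summable_on_complete) simp

lemma decay_sum_mono:
  assumes "U' \<subseteq> U"
  shows "decay_sum S B l U' V \<le> decay_sum S B l U V"
  unfolding decay_sum_def using assms by (intro infsum_mono_neutral) auto

lemma infsum_add_ennreal: "(\<Sum>\<^sub>\<infinity>x\<in>A. f x + g x) = infsum f A + infsum (g :: _ \<Rightarrow> ennreal) A"
  by (rule infsum_add) auto

lemma infsum_le_cmult_ennreal:
  fixes f g :: "'a \<Rightarrow> ennreal"
  assumes "\<And>x. x \<in> A \<Longrightarrow> f x \<le> c * g x"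
  shows "infsum f A \<le> c * infsum g A"
proof (rule infsum_le_finite_sums)
  fix F assume F: "finite F" "F \<subseteq> A"
  have "sum f F \<le> (\<Sum>x\<in>F. c * g x)" using assms F by (intro sum_mono) auto
  also have "\<dots> = c * infsum g F" using F by (simp add: sum_distrib_left)
  also have "\<dots> \<le> c * infsum g A"
    using F by (intro mult_left_mono infsum_mono_neutral) auto
  finally show "sum f F \<le> c * infsum g A" .
qed auto

lemma infsum_sum_swap_ennreal:
  fixes f :: "'a \<Rightarrow> 'b \<Rightarrow> ennreal"
  assumes "finite A"
  shows "(\<Sum>x\<in>A. \<Sum>\<^sub>\<infinity>y\<in>C. f x y) = (\<Sum>\<^sub>\<infinity>y\<in>C. \<Sum>x\<in>A. f x y)"
  using assms by (induction A) (simp_all add: infsum_add_ennreal)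

section \<open>Decay sums over the boundary of the separating set\<close>

context bounded_degree_graph
begin

text \<open>The rate \<open>l\<close> is split in two: \<open>l - b\<close> exceeds the growth rate
  and makes the sum over \<open>W\<close> uniformly bounded, while the remaining factor e^(-bd) is
  at most e^(bk) e^(-bn/2) since d \<ge> n/2 - k.\<close>

lemma sum_exp_dist_le_exp:
  assumes "t \<in> S" "finite W" "W \<subseteq> S" and b: "l - b > growth_rate S B" and "b \<ge> 0"
    and far: "\<And>w. w \<in> W \<Longrightarrow> n \<le> 2 * d t w + 2 * k"
  shows "(\<Sum>w\<in>W. exp (- l * real (d t w))) \<le>
    exp (b * real k) / (1 - exp (growth_rate S B - (l - b))) * exp (- (b / 2) * real n)"
proof -
  have "exp (- l * real (d t w)) \<le>
      exp (b * real k) * exp (- (b / 2) * real n) * exp (- (l - b) * real (d t w))" if "w \<in> W" for w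
  proof -
    have "real n \<le> 2 * real (d t w) + 2 * real k" using far[OF that] by linarith
    then have "b * real n \<le> b * (2 * real (d t w) + 2 * real k)" using \<open>b \<ge> 0\<close> by (rule mult_left_mono)
    then show ?thesis by (simp add: exp_add[symmetric] algebra_simps)
  qed
  then have "(\<Sum>w\<in>W. exp (- l * real (d t w))) \<le>
      exp (b * real k) * exp (- (b / 2) * real n) * (\<Sum>w\<in>W. exp (- (l - b) * real (d t w)))"
    unfolding sum_distrib_left by (rule sum_mono)
  also have "\<dots> \<le> exp (b * real k) * exp (- (b / 2) * real n) * (1 / (1 - exp (growth_rate S B - (l - b))))"
    using assms by (intro mult_left_mono sum_exp_dist_le) auto
  finally show ?thesis by simp
qed

text \<open>Each point of \<open>U\<close> or \<open>V\<close> has boundary sum at most K e^(-bn/2),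
  where n is its distance to the other set. This exponential is the single term of a nearest point,
  hence at most the whole sum over that other set. Summing over \<open>U\<close> and over
  \<open>V\<close> gives \<open>K\<close> times the decay sum twice.\<close>

lemma decay_sum_boundary_le:
  fixes l b :: real and k :: nat
  assumes U: "finite U" "U \<subseteq> S" "U \<noteq> {}" and V: "V \<subseteq> S" "V \<noteq> {}"
    and b: "l - b > growth_rate S B" "b \<ge> 0"
  defines "W \<equiv> boundary S B k (separating_set U V)"
    and "K \<equiv> exp (b * real k) / (1 - exp (growth_rate S B - (l - b)))"
  shows "decay_sum S B l W (U \<union> V) \<le> ennreal (2 * K) * decay_sum S B (b / 2) U V"
proof -
  let ?e = "\<lambda>l t s. ennreal (exp (- l * real (d t s)))"
  have K: "K \<ge> 0" unfolding K_def using b(1) by (intro divide_nonneg_nonneg) auto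
  have finW: "finite W" unfolding W_def
    using finite_boundary[OF finite_separating_set[OF U(1,2) V(2)] separating_set_subset] .
  have WS: "W \<subseteq> S" by (auto simp: W_def boundary_def)
  have left: "(\<Sum>w\<in>W. ?e l w t) \<le> ennreal K * (\<Sum>\<^sub>\<infinity>v\<in>V. ?e (b / 2) t v)" if t: "t \<in> U" for t
  proof -
    have tS: "t \<in> S" using t U by auto
    define n where "n = (LEAST n. \<exists>v\<in>V. d t v = n)"
    have "\<exists>v\<in>V. d t v = n" unfolding n_def by (rule LeastI_ex) (use V in auto)
    then obtain v where v: "v \<in> V" "d t v = n" by blast
    have min: "n \<le> d t v'" if "v' \<in> V" for v' unfolding n_def by (rule Least_le) (use that in blast)
    have "n \<le> 2 * d t w + 2 * k" if "w \<in> W" for w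
      using boundary_far_from_left[OF that[unfolded W_def] t] min by (meson order_trans le_add1)
    from sum_exp_dist_le_exp[OF tS finW WS b this]
    have "(\<Sum>w\<in>W. exp (- l * real (d t w))) \<le> K * exp (- (b / 2) * real n)"
      by (simp add: K_def)
    moreover have "d t w = d w t" if "w \<in> W" for w
      using graph_dist_commute tS WS that by blast
    ultimately have "(\<Sum>w\<in>W. exp (- l * real (d w t))) \<le> K * exp (- (b / 2) * real n)" by simp
    then have "(\<Sum>w\<in>W. ?e l w t) \<le> ennreal (K * exp (- (b / 2) * real n))"
      by (subst sum_ennreal) (auto intro: ennreal_leI)
    also have "\<dots> = ennreal K * (\<Sum>\<^sub>\<infinity>v\<in>{v}. ?e (b / 2) t v)" using K v by (simp add: ennreal_mult)
    also have "\<dots> \<le> ennreal K * (\<Sum>\<^sub>\<infinity>v\<in>V. ?e (b / 2) t v)"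
      using v by (intro mult_left_mono infsum_mono_neutral) auto
    finally show ?thesis .
  qed
  have right: "(\<Sum>w\<in>W. ?e l w v) \<le> ennreal K * (\<Sum>t\<in>U. ?e (b / 2) t v)" if v: "v \<in> V" for v
  proof -
    have vS: "v \<in> S" using v V by auto
    define n where "n = (LEAST n. \<exists>t\<in>U. d t v = n)"
    have "\<exists>t\<in>U. d t v = n" unfolding n_def by (rule LeastI_ex) (use U in auto)
    then obtain t where t: "t \<in> U" "d t v = n" by blast
    have min: "n \<le> d t' v" if "t' \<in> U" for t' unfolding n_def by (rule Least_le) (use that in blast)
    have "n \<le> 2 * d v w + 2 * k" if "w \<in> W" for w
      using boundary_far_from_right[OF that[unfolded W_def] v U(2) V(1) U(3)] min by (meson order_trans)
    from sum_exp_dist_le_exp[OF vS finW WS b this]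
    have "(\<Sum>w\<in>W. exp (- l * real (d v w))) \<le> K * exp (- (b / 2) * real n)"
      by (simp add: K_def)
    moreover have "d v w = d w v" if "w \<in> W" for w
      using graph_dist_commute vS WS that by blast
    ultimately have "(\<Sum>w\<in>W. exp (- l * real (d w v))) \<le> K * exp (- (b / 2) * real n)" by simp
    then have "(\<Sum>w\<in>W. ?e l w v) \<le> ennreal (K * exp (- (b / 2) * real n))"
      by (subst sum_ennreal) (auto intro: ennreal_leI)
    also have "\<dots> = ennreal K * (\<Sum>t\<in>{t}. ?e (b / 2) t v)" using K t by (simp add: ennreal_mult)
    also have "\<dots> \<le> ennreal K * (\<Sum>t\<in>U. ?e (b / 2) t v)"
      using t U by (intro mult_left_mono sum_mono2) auto
    finally show ?thesis .
  qed
  have "decay_sum S B l W (U \<union> V) = (\<Sum>\<^sub>\<infinity>s\<in>U \<union> V. \<Sum>w\<in>W. ?e l w s)"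
    unfolding decay_sum_def using finW by (simp add: infsum_sum_swap_ennreal)
  also have "\<dots> = (\<Sum>\<^sub>\<infinity>s\<in>U \<union> (V - U). \<Sum>w\<in>W. ?e l w s)" by simp
  also have "\<dots> = (\<Sum>\<^sub>\<infinity>s\<in>U. \<Sum>w\<in>W. ?e l w s) + (\<Sum>\<^sub>\<infinity>s\<in>V - U. \<Sum>w\<in>W. ?e l w s)"
    by (rule infsum_Un_disjoint) auto
  also have "(\<Sum>\<^sub>\<infinity>s\<in>V - U. \<Sum>w\<in>W. ?e l w s) \<le> (\<Sum>\<^sub>\<infinity>s\<in>V. \<Sum>w\<in>W. ?e l w s)"
    by (rule infsum_mono_neutral) auto
  also have "\<dots> \<le> ennreal K * (\<Sum>\<^sub>\<infinity>v\<in>V. \<Sum>t\<in>U. ?e (b / 2) t v)"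
    using right by (rule infsum_le_cmult_ennreal)
  also have "(\<Sum>\<^sub>\<infinity>v\<in>V. \<Sum>t\<in>U. ?e (b / 2) t v) = decay_sum S B (b / 2) U V"
    unfolding decay_sum_def using U by (simp add: infsum_sum_swap_ennreal)
  also have "(\<Sum>\<^sub>\<infinity>s\<in>U. \<Sum>w\<in>W. ?e l w s) \<le> ennreal K * decay_sum S B (b / 2) U V"
    unfolding decay_sum_def using left by (rule infsum_le_cmult_ennreal)
  finally have "decay_sum S B l W (U \<union> V) \<le>
      ennreal K * decay_sum S B (b / 2) U V + ennreal K * decay_sum S B (b / 2) U V"
    by (simp add: add_right_mono)
  also have "\<dots> = ennreal (2 * K) * decay_sum S B (b / 2) U V"
    using K by (simp add: ennreal_mult distrib_right[symmetric] mult_2[symmetric] mult.assoc)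
  finally show ?thesis .
qed

text \<open>A common vertex alone contributes the term e^0 = 1.\<close>

lemma disjoint_if_decay_sum_less_1:
  assumes "decay_sum S B l U V < 1" "U \<subseteq> S"
  shows "U \<inter> V = {}"
proof (rule ccontr)
  assume "U \<inter> V \<noteq> {}"
  then obtain t where t: "t \<in> U" "t \<in> V" by blast
  then have "t \<in> S" using assms by auto
  have "decay_sum S B l {t} {t} \<le> (\<Sum>\<^sub>\<infinity>s\<in>V. ennreal (exp (- l * real (d t s))))"
  proof -
    have "(\<Sum>\<^sub>\<infinity>s\<in>{t}. ennreal (exp (- l * real (d t s)))) \<le> (\<Sum>\<^sub>\<infinity>s\<in>V. ennreal (exp (- l * real (d t s))))"
      using t by (intro infsum_mono_neutral) auto
    then show ?thesis by (simp add: decay_sum_def)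
  qed
  also have "\<dots> = decay_sum S B l {t} V" by (simp add: decay_sum_def)
  also have "\<dots> \<le> decay_sum S B l U V" using t by (intro decay_sum_mono) auto
  finally have "decay_sum S B l {t} {t} < 1" using assms by simp
  with \<open>t \<in> S\<close> show False by (simp add: decay_sum_def graph_dist_self)
qed

lemma decay_sum_pos:
  assumes "t \<in> U" "v \<in> V"
  shows "decay_sum S B l U V > 0"
proof -
  have "0 < (\<Sum>\<^sub>\<infinity>s\<in>{v}. ennreal (exp (- l * real (d t s))))" by simp
  also have "\<dots> \<le> (\<Sum>\<^sub>\<infinity>s\<in>V. ennreal (exp (- l * real (d t s))))"
    using assms by (intro infsum_mono_neutral) auto
  also have "\<dots> = decay_sum S B l {t} V" by (simp add: decay_sum_def)
  also have "\<dots> \<le> decay_sum S B l U V" using assms by (intro decay_sum_mono) auto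
  finally show ?thesis .
qed

end

section \<open>From \<open>\<phi>\<close>-mixing to \<open>\<psi>\<close>-mixing\<close>

theorem theorem3p4:
  fixes S :: "'s set" and B :: "'s set set" and E :: "'e set"
    and \<mu> :: "('s \<Rightarrow> 'e) measure"
    and \<kappa> :: "'s set \<Rightarrow> ('s \<Rightarrow> 'e) \<Rightarrow> ('s \<Rightarrow> 'e) measure"
    and \<theta> l :: real and k :: nat
  assumes "countable S" and "infinite S"
    and "simple_graph S B" and "connected_graph S B" and "bounded_degree S B"
    and "\<theta> = growth_rate S B"
    and "finite E"
    and "prob_space \<mu>" and "sets \<mu> = sets (config_borel S E)"
    and "regular_cond_probs S E \<mu> \<kappa>"
    and "nondegenerate S E \<mu> \<kappa>"
    and "l > 3 * \<theta>"
    and "markovian S B k \<mu> \<kappa>"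
    and "exp_mixing S B (phi_coeff S E \<mu>) l"
  shows "exp_mixing S B (psi_coeff S E \<mu>) ((l - 3 * \<theta>) / 9)"
proof -
  interpret bounded_degree_graph S B by unfold_locales fact+
  interpret prob_space \<mu> by fact
  note sets = \<open>sets \<mu> = sets (config_borel S E)\<close>
  have space: "space \<mu> = config_space S E" using sets_eq_imp_space_eq[OF sets] by simp
  have sub: "sets (local_algebra S E F) \<subseteq> sets \<mu>" if "F \<subseteq> S" for F
    using sets_local_algebra_subset_config_borel[OF that, of E] sets by simp
  obtain C where C: "C \<ge> 1" and phi: "\<forall>U V. U \<subseteq> S \<and> V \<subseteq> S \<and> ennreal C * decay_sum S B l U V < 1 \<longrightarrow>
      phi_coeff S E \<mu> U V \<le> ennreal C * decay_sum S B l U V"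
    using \<open>exp_mixing S B (phi_coeff S E \<mu>) l\<close> unfolding exp_mixing_def by (elim exE conjE)
  \<comment> \<open>Passing to the boundary halves the rate, so \<open>b\<close> is twice the target
    rate. Since l > 3\<theta>, the remainder (7l + 6\<theta>)/9 exceeds 3\<theta> \<ge> \<theta>, as
    convergence over the boundary requires.\<close>
  define b where "b = 2 * (l - 3 * \<theta>) / 9"
  have \<theta>: "\<theta> \<ge> 0" using growth_rate_nonneg \<open>\<theta> = _\<close> by simp
  have b: "l - b > growth_rate S B" "b \<ge> 0"
    using \<open>l > 3 * \<theta>\<close> \<theta> by (auto simp: b_def \<open>\<theta> = _\<close>[symmetric] field_simps)
  have b2: "(l - 3 * \<theta>) / 9 = b / 2" by (simp add: b_def)
  define K where "K = exp (b * real k) / (1 - exp (growth_rate S B - (l - b)))"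
  have "K \<ge> 1"
  proof -
    have pos: "0 < 1 - exp (growth_rate S B - (l - b))" using b by simp
    have "1 - exp (growth_rate S B - (l - b)) \<le> 1" by simp
    also have "1 \<le> exp (b * real k)" using b by simp
    finally show ?thesis unfolding K_def using pos by (simp only: pos_le_divide_eq mult_1)
  qed
  \<comment> \<open>The factor \<open>2 * K\<close> comes from \<open>decay_sum_boundary_le\<close>,
    the factor \<open>C\<close> from the assumed \<phi>-mixing.\<close>
  define C2 where "C2 = 2 * C * K"
  have "C * K \<ge> 1" using C \<open>K \<ge> 1\<close> by (metis mult_mono' mult_1 zero_le_one)
  then have C2: "C2 \<ge> 2" by (simp add: C2_def)
  have main: "\<bar>prob (A \<inter> Q) - prob A * prob Q\<bar> \<le> 49 * \<epsilon> * (prob A * prob Q)"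
    if U: "finite U" "U \<subseteq> S" "U \<noteq> {}" and V: "V \<subseteq> S" "V \<noteq> {}"
      and A: "A \<in> sets (local_algebra S E U)" and Q: "Q \<in> sets (local_algebra S E V)"
      and \<epsilon>: "0 < \<epsilon>" "\<epsilon> < 1 / 49" and decay: "ennreal C2 * decay_sum S B (b / 2) U V \<le> ennreal \<epsilon>"
    for U V A Q \<epsilon>
  proof -
    let ?\<sigma> = "decay_sum S B (b / 2) U V"
    define D where "D = separating_set U V"
    define W where "W = boundary S B k D"
    have D: "finite D" "D \<subseteq> S" "U \<subseteq> D"
      using finite_separating_set[OF U(1,2) V(2)] separating_set_subset subset_separating_set[OF U(2)]
      by (auto simp: D_def)
    have W: "finite W" "W \<subseteq> S" using finite_boundary[OF D(1,2)] by (auto simp: W_def boundary_def)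
    \<comment> \<open>As \<open>C2 \<ge> 1\<close>, the decay sum is below 1. Hence \<open>U\<close>
      and \<open>V\<close> are disjoint, and \<open>V\<close> lies outside \<open>D\<close>, where
      conditional independence needs it.\<close>
    have "ennreal 1 * ?\<sigma> \<le> ennreal C2 * ?\<sigma>" using C2 by (intro mult_right_mono ennreal_leI) auto
    then have "?\<sigma> \<le> ennreal \<epsilon>" using decay by simp
    also have "\<dots> < ennreal 1" using \<epsilon> by (subst ennreal_less_iff) auto
    finally have "U \<inter> V = {}" by (intro disjoint_if_decay_sum_less_1[OF _ U(2)]) simp
    then have VD: "V \<subseteq> S - D" using separating_set_disjoint U V by (auto simp: D_def)
    have AD: "A \<in> sets (local_algebra S E D)" and QD: "Q \<in> sets (local_algebra S E (S - D))"
      using A Q sets_local_algebra_mono[OF D(3)] sets_local_algebra_mono[OF VD] by blast+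
    have "ennreal C * decay_sum S B l W (U \<union> V) \<le> ennreal C * (ennreal (2 * K) * ?\<sigma>)"
      unfolding W_def D_def K_def using decay_sum_boundary_le[OF U V b] by (intro mult_left_mono) auto
    also have "\<dots> = ennreal C2 * ?\<sigma>"
      using C \<open>K \<ge> 1\<close> by (simp add: C2_def ennreal_mult[symmetric] mult.assoc[symmetric] mult.commute)
    also note decay
    finally have le: "ennreal C * decay_sum S B l W (U \<union> V) \<le> ennreal \<epsilon>" .
    also have "\<dots> < ennreal 1" using \<epsilon> by (subst ennreal_less_iff) auto
    \<comment> \<open>With \<open>W\<close> as first argument, the conditioning is on events of
      \<open>U \<union> V\<close>, which include A, Q and A \<inter> Q; unions of cells belong to
      \<open>W\<close>.\<close>
    finally have "phi_coeff S E \<mu> W (U \<union> V) \<le> ennreal C * decay_sum S B l W (U \<union> V)"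
      using W U V by (intro phi[rule_format]) auto
    with le have phi\<epsilon>: "phi_coeff S E \<mu> W (U \<union> V) \<le> ennreal \<epsilon>" by (rule order_trans[rotated])
    let ?I = "\<Pi>\<^sub>E s\<in>W. E" and ?P = "cylinder S E W"
    have PW: "?P w \<in> sets (local_algebra S E W)" for w using W by (rule cylinder_in_local_algebra)
    have finI: "finite ?I" using W \<open>finite E\<close> by (intro finite_PiE) auto
    have AUV: "A \<in> sets (local_algebra S E (U \<union> V))" "Q \<in> sets (local_algebra S E (U \<union> V))"
      using A Q sets_local_algebra_mono[of U "U \<union> V" S E] sets_local_algebra_mono[of V "U \<union> V" S E] by auto
    show ?thesis
    proof (rule ratio_bound_of_cond_indep[OF finI])
      fix J R assume J: "J \<subseteq> ?I" and "R \<in> {A, Q, A \<inter> Q}"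
      then have "R \<in> sets (local_algebra S E (U \<union> V))" using AUV by auto
      moreover have "(\<Union>i\<in>J. ?P i) \<in> sets (local_algebra S E W)"
        using PW finite_subset[OF J finI] by auto
      ultimately show "\<bar>prob (R \<inter> (\<Union>i\<in>J. ?P i)) - prob R * prob (\<Union>i\<in>J. ?P i)\<bar> \<le> \<epsilon> * prob R"
        using \<epsilon> U V by (intro phi_coeffD[OF \<open>prob_space \<mu>\<close> space phi\<epsilon>] sub W) auto
    next
      fix w
      show "prob (A \<inter> ?P w \<inter> Q) * prob (?P w) = prob (A \<inter> ?P w) * prob (?P w \<inter> Q)"
        by (rule markovian_cond_indep[OF \<open>prob_space \<mu>\<close> sets \<open>regular_cond_probs S E \<mu> \<kappa>\<close>
              \<open>markovian S B k \<mu> \<kappa>\<close> D(1,2) W_def W(1) AD QD refl])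
    next
      show "?P w \<in> events" for w using PW sub[OF W(2)] by blast
      show "A \<in> events" "Q \<in> events" using A Q sub U V by auto
      show "(\<Union>w\<in>?I. ?P w) = space \<mu>" unfolding space by (rule Union_cylinders[OF W(2)])
      show "disjoint_family_on ?P ?I" by (rule disjoint_cylinders)
    qed (use \<epsilon> in auto)
  qed
  show ?thesis unfolding exp_mixing_def b2
  \<comment> \<open>The factor 49 is that of \<open>main\<close>. It also turns the smallness
    assumption into \<epsilon> < 1/49, so that 7\<epsilon> \<le> 1/2.\<close>
  proof (intro exI[of _ "49 * C2"] conjI allI impI)
    show "1 \<le> 49 * C2" using C2 by simp
    fix U V assume "U \<subseteq> S \<and> V \<subseteq> S \<and> ennreal (49 * C2) * decay_sum S B (b / 2) U V < 1"
    then have U: "U \<subseteq> S" and V: "V \<subseteq> S" and less: "ennreal (49 * C2) * decay_sum S B (b / 2) U V < 1" by auto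
    let ?\<sigma> = "decay_sum S B (b / 2) U V"
    obtain \<epsilon> where \<epsilon>: "\<epsilon> \<ge> 0" "ennreal (49 * C2) * ?\<sigma> = ennreal (49 * \<epsilon>)" "\<epsilon> < 1 / 49"
      "ennreal C2 * ?\<sigma> = ennreal \<epsilon>"
    proof -
      have eq: "ennreal (49 * C2) * ?\<sigma> = ennreal 49 * (ennreal C2 * ?\<sigma>)"
        using C2 by (simp add: ennreal_mult mult.assoc)
      have "ennreal C2 * ?\<sigma> \<noteq> \<top>" using less unfolding eq by (auto simp: ennreal_mult_top)
      then obtain \<epsilon> where "\<epsilon> \<ge> 0" "ennreal C2 * ?\<sigma> = ennreal \<epsilon>" by (metis ennreal_cases)
      moreover from this have "ennreal (49 * C2) * ?\<sigma> = ennreal (49 * \<epsilon>)"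
        unfolding eq by (simp add: ennreal_mult)
      moreover from this have "ennreal (49 * \<epsilon>) < ennreal 1" using less by simp
      then have "\<epsilon> < 1 / 49" using \<open>\<epsilon> \<ge> 0\<close> by (simp add: ennreal_less_iff del: ennreal_1)
      ultimately show ?thesis using that by blast
    qed
    show "psi_coeff S E \<mu> U V \<le> ennreal (49 * C2) * ?\<sigma>"
      unfolding psi_coeff_def \<epsilon>(2)
    proof (rule Sup_least, clarify)
      fix A Q assume A: "A \<in> sets (local_algebra S E U)" and Q: "Q \<in> sets (local_algebra S E V)"
        and pos: "prob A > 0" "prob Q > 0"
      have AM: "A \<in> events" "Q \<in> events" using A Q sub U V by auto
      \<comment> \<open>For empty \<open>V\<close> only trivial events \<open>Q\<close> occur.
        Otherwise the bound is shown for finite subsets of \<open>U\<close> and extended by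
        approximation; the decay sum is monotone in \<open>U\<close>, so one
        \<open>\<epsilon>\<close> serves all of them.\<close>
      have "\<bar>prob (A \<inter> Q) - prob A * prob Q\<bar> \<le> 49 * \<epsilon> * (prob A * prob Q)"
      proof (cases "V = {}")
        case True
        with Q have "Q = {} \<or> Q = space \<mu>" by (simp add: sets_local_algebra_empty space)
        then show ?thesis
        proof
          assume "Q = space \<mu>"
          with AM \<epsilon>(1) show ?thesis by (simp add: prob_space)
        qed (use pos in simp)
      next
        case False
        show ?thesis
        proof (rule ratio_bound_local[OF \<open>prob_space \<mu>\<close> sets U AM(2) _ _ A])
          fix F A' assume F: "finite F" "F \<subseteq> U" and A': "A' \<in> sets (local_algebra S E F)"
          show "\<bar>prob (A' \<inter> Q) - prob A' * prob Q\<bar> \<le> 49 * \<epsilon> * (prob A' * prob Q)"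
          proof (cases "F = {}")
            case True
            with A' have "A' = {} \<or> A' = space \<mu>" by (simp add: sets_local_algebra_empty space)
            then show ?thesis
            proof
              assume "A' = space \<mu>"
              with AM \<epsilon>(1) show ?thesis by (simp add: prob_space)
            qed simp
          next
            case ne: False
            have "ennreal C2 * decay_sum S B (b / 2) F V \<le> ennreal \<epsilon>"
              unfolding \<epsilon>(4)[symmetric] by (intro mult_left_mono decay_sum_mono F) auto
            \<comment> \<open>The bound \<open>main\<close> asks for \<epsilon> > 0, which holds
              because the decay sum of nonempty sets is positive.\<close>
            moreover have "0 < ennreal C2 * decay_sum S B (b / 2) F V"
            proof -
              obtain t v where "t \<in> F" "v \<in> V" using False ne by blast
              then show ?thesis using decay_sum_pos[of t F v V "b / 2"] C2
                by (simp add: ennreal_zero_less_mult_iff)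
            qed
            ultimately have "0 < ennreal \<epsilon>" by (rule order.strict_trans2[rotated])
            then have "\<epsilon> > 0" by simp
            with False ne F U V A' Q \<epsilon>(3) \<open>_ \<le> ennreal \<epsilon>\<close> show ?thesis by (intro main[of F V]) auto
          qed
        qed (use \<epsilon>(1) in auto)
      qed
      then have "\<bar>prob (A \<inter> Q) - prob A * prob Q\<bar> / (prob A * prob Q) \<le> 49 * \<epsilon>"
        using pos by (simp add: divide_le_eq)
      moreover have "prob (A \<inter> Q) / (prob A * prob Q) - 1 = (prob (A \<inter> Q) - prob A * prob Q) / (prob A * prob Q)"
        using pos by (simp add: field_simps)
      ultimately have "\<bar>prob (A \<inter> Q) / (prob A * prob Q) - 1\<bar> \<le> 49 * \<epsilon>"
        using pos by (simp add: abs_divide abs_mult)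
      then show "ennreal \<bar>prob (A \<inter> Q) / (prob A * prob Q) - 1\<bar> \<le> ennreal (49 * \<epsilon>)"
        by (rule ennreal_leI)
    qed
  qed
qed

end
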